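(* Let $d\ge 1$, let $W$ be a strict contraction on $\mathbb{C}^d$, let $\Theta$ be a pure inner function with values in $\mathcal{L}(\mathbb{C}^d)$, and let $$\Theta'(\lambda)=-W+D_{W^*}(I-\Theta(\lambda)W^* )^{-1}\Theta(\lambda)D_W .$$ Then the map $J_W$ defined by $$(J_Wf)(\lambda)=D_{W^*}(I-\Theta(\lambda)W^* )^{-1}f(\lambda)$$ is a unitary operator from $K_\Theta$ to $K_{\Theta'}$.
   Context: $\mathcal{L}(\mathbb{C}^d)$ is the algebra of linear operators on the Hilbert space $\mathbb{C}^d$ (i.e. $d\times d$ matrices), and $\mathbb{D}$ is the open unit disc, $\mathbb{T}$ the unit circle. $H^2(\mathbb{C}^d)$ is the Hardy space of $\mathbb{C}^d$-valued functions: the subspace of $L^2(\mathbb{T};\mathbb{C}^d)$ (normalized Lebesgue measure) of functions with vanishing negative Fourier coefficients, identified with analytic functions on $\mathbb{D}$; boundary values are radial limits a.e. An inner function is an element $\Theta\in H^2(\mathcal{L}(\mathbb{C}^d))$ whose boundary values are unitary a.e. on $\mathbb{T}$; it is pure if $\|\Theta(0)\|<1$. The model space is $K_\Theta=H^2(\mathbb{C}^d)\ominus\Theta H^2(\mathbb{C}^d)$. A strict contraction is an operator $W$ with $\|W\|<1$; $D_W=(I-W^*W)^{1/2}$ and $D_{W^*}=(I-WW^* )^{1/2}$. The function $\Theta'$ is again a pure inner function, so $K_{\Theta'}$ is defined in the same way. *)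

theory Defs
  imports "HOL-Analysis.Analysis"
begin

section \<open>Operators on the Hilbert space of complex d-tuples\<close>

text \<open>
  The inner product \<open>(\<bullet>)\<close> that the library provides on \<^typ>\<open>complex ^ 'd\<close> is the real part of
  the following one; the norms agree.
\<close>

definition cinner :: "complex ^ 'd \<Rightarrow> complex ^ 'd \<Rightarrow> complex" where
  "cinner x y = (\<Sum>i\<in>UNIV. x $ i * cnj (y $ i))"

definition adj :: "complex ^ 'n ^ 'm \<Rightarrow> complex ^ 'm ^ 'n" where
  "adj A = (\<chi> i j. cnj (A $ j $ i))"

definition unitary_matrix :: "complex ^ 'd ^ 'd \<Rightarrow> bool" where
  "unitary_matrix U \<longleftrightarrow> adj U ** U = mat 1 \<and> U ** adj U = mat 1"

definition positive_matrix :: "complex ^ 'd ^ 'd \<Rightarrow> bool" where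
  "positive_matrix A \<longleftrightarrow> (\<forall>x. cinner (A *v x) x \<in> \<real>\<^sub>\<ge>\<^sub>0)"

definition smult_matrix :: "complex \<Rightarrow> complex ^ 'n ^ 'm \<Rightarrow> complex ^ 'n ^ 'm" where
  "smult_matrix c A = (\<chi> i j. c * A $ i $ j)"

text \<open>Only meaningful for positive \<open>A\<close>.\<close>

definition sqrt_matrix :: "complex ^ 'd ^ 'd \<Rightarrow> complex ^ 'd ^ 'd" where
  "sqrt_matrix A = (THE B. positive_matrix B \<and> B ** B = A)"

definition opnorm :: "complex ^ 'd ^ 'd \<Rightarrow> real" where
  "opnorm A = onorm ((*v) A)"

definition strict_contraction :: "complex ^ 'd ^ 'd \<Rightarrow> bool" where
  "strict_contraction W \<longleftrightarrow> opnorm W < 1"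

text \<open>The second defect operator is \<open>defect (adj W)\<close>.\<close>

definition defect :: "complex ^ 'd ^ 'd \<Rightarrow> complex ^ 'd ^ 'd" where
  "defect W = sqrt_matrix (mat 1 - adj W ** W)"


section \<open>Hardy spaces\<close>

text \<open>
  Functions on the unit circle are written as functions of the angle \<open>t \<in> [0, 2\<pi>]\<close>, and the
  normalized measure of the circle is \<open>1 / (2\<pi>)\<close> times Lebesgue measure on this interval.
\<close>

abbreviation circle :: "real measure" where
  "circle \<equiv> lebesgue_on {0..2 * pi}"

definition L2_circle :: "(real \<Rightarrow> 'v::euclidean_space) set" where
  "L2_circle = {f. f \<in> borel_measurable circle \<and> integrable circle (\<lambda>t. (norm (f t))\<^sup>2)}"

text \<open>
  The argument \<open>sc\<close> is the multiplication by complex scalars on the space of values, namely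
  \<open>(*s)\<close> for vectors and \<open>smult_matrix\<close> for matrices.
\<close>

definition fourier_coeff ::
    "(complex \<Rightarrow> 'v \<Rightarrow> 'v) \<Rightarrow> (real \<Rightarrow> 'v::euclidean_space) \<Rightarrow> int \<Rightarrow> 'v" where
  "fourier_coeff sc f n =
     (1 / (2 * pi)) *\<^sub>R (LINT t|circle. sc (cis (- (of_int n * t))) (f t))"

definition boundary :: "(complex \<Rightarrow> 'v::euclidean_space) \<Rightarrow> real \<Rightarrow> 'v" where
  "boundary F t = Lim (at_left 1) (\<lambda>r. F (of_real r * cis t))"

text \<open>
  An element of the Hardy space is a square integrable function on the circle without negative
  Fourier coefficients, identified with the analytic function on the open unit disc whose Taylor
  coefficients are its Fourier coefficients. The function on the circle is recovered from the
  analytic one by radial limits almost everywhere (for every such analytic function these exist,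
  by Fatou's theorem, so that the first clause excludes nothing). Only the values of \<open>F\<close> on the
  open disc matter.
\<close>

definition hardy2 :: "(complex \<Rightarrow> 'v \<Rightarrow> 'v) \<Rightarrow> (complex \<Rightarrow> 'v::euclidean_space) \<Rightarrow> bool" where
  "hardy2 sc F \<longleftrightarrow>
     (AE t in circle. ((\<lambda>r. F (of_real r * cis t)) \<longlongrightarrow> boundary F t) (at_left 1)) \<and>
     boundary F \<in> L2_circle \<and>
     (\<forall>n<0. fourier_coeff sc (boundary F) n = 0) \<and>
     (\<forall>z\<in>ball 0 1. (\<lambda>n. sc (z ^ n) (fourier_coeff sc (boundary F) (int n))) sums F z)"

text \<open>
  The elements of the Hardy space of vector-valued functions are extended by \<open>0\<close> to the outside of
  the open disc, so that they are equal as soon as they agree on the disc.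
\<close>

definition H2 :: "(complex \<Rightarrow> complex ^ 'd) set" where
  "H2 = {F. hardy2 (*s) F \<and> (\<forall>z. z \<notin> ball 0 1 \<longrightarrow> F z = 0)}"

definition H2_inner :: "(complex \<Rightarrow> complex ^ 'd) \<Rightarrow> (complex \<Rightarrow> complex ^ 'd) \<Rightarrow> complex" where
  "H2_inner F G = (1 / (2 * pi)) *\<^sub>R (LINT t|circle. cinner (boundary F t) (boundary G t))"

definition inner_function :: "(complex \<Rightarrow> complex ^ 'd ^ 'd) \<Rightarrow> bool" where
  "inner_function \<Theta> \<longleftrightarrow> hardy2 smult_matrix \<Theta> \<and> (AE t in circle. unitary_matrix (boundary \<Theta> t))"

definition pure :: "(complex \<Rightarrow> complex ^ 'd ^ 'd) \<Rightarrow> bool" where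
  "pure \<Theta> \<longleftrightarrow> opnorm (\<Theta> 0) < 1"

definition model_space ::
    "(complex \<Rightarrow> complex ^ 'd ^ 'd) \<Rightarrow> (complex \<Rightarrow> complex ^ 'd) set" where
  "model_space \<Theta> = {F \<in> H2. \<forall>G\<in>H2. H2_inner F (\<lambda>z. \<Theta> z *v G z) = 0}"


section \<open>Unitary operators between subspaces of the Hardy space\<close>

definition unitary_operator ::
    "(complex \<Rightarrow> complex ^ 'd) set \<Rightarrow> (complex \<Rightarrow> complex ^ 'd) set
       \<Rightarrow> ((complex \<Rightarrow> complex ^ 'd) \<Rightarrow> complex \<Rightarrow> complex ^ 'd) \<Rightarrow> bool" where
  "unitary_operator K L J \<longleftrightarrow>
     bij_betw J K L \<and>
     (\<forall>F\<in>K. \<forall>G\<in>K. J (\<lambda>z. F z + G z) = (\<lambda>z. J F z + J G z)) \<and>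
     (\<forall>c. \<forall>F\<in>K. J (\<lambda>z. c *s F z) = (\<lambda>z. c *s J F z)) \<and>
     (\<forall>F\<in>K. \<forall>G\<in>K. H2_inner (J F) (J G) = H2_inner F G)"

end

theory Submission
  imports Defs
begin

text \<open>
  Write \<open>R = (I - \<Theta>W\<^sup>*)\<^sup>-\<^sup>1\<close>, \<open>M = D\<^sub>* R\<close> with \<open>D = D\<^sub>W\<close> and \<open>D\<^sub>* = D\<^bsub>W*\<^esub>\<close>, so that \<open>J\<close> is the
  multiplication by \<open>M\<close>. At almost every point of the circle \<open>\<Theta>\<close> is unitary, and two matrix
  identities hold there (\<open>multiplier_gram\<close> and \<open>multiplier_adj_moebius\<close>):
  \<open>M\<^sup>*M = I + \<Theta>W\<^sup>*R + (\<Theta>W\<^sup>*R)\<^sup>*\<close> and \<open>M\<^sup>*\<Theta>' = R\<Theta>D\<close>. Moreover \<open>R\<Theta> = \<Theta>(I + W\<^sup>*R\<Theta>)\<close>.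

  For \<open>f\<close>, \<open>g\<close> in the model space of \<open>\<Theta>\<close>, the first identity gives
  \<open>\<langle>Jf, Jg\<rangle> = \<langle>f, g\<rangle> + \<langle>\<Theta>W\<^sup>*Rf, g\<rangle> + \<langle>f, \<Theta>W\<^sup>*Rg\<rangle> = \<langle>f, g\<rangle>\<close>, because \<open>W\<^sup>*Rf\<close> and \<open>W\<^sup>*Rg\<close> are in the
  Hardy space. The second one gives \<open>\<langle>Jf, \<Theta>'g\<rangle> = \<langle>f, R\<Theta>Dg\<rangle>\<close> for every \<open>f\<close> and \<open>g\<close> in the Hardy
  space; as \<open>R\<Theta>Dg\<close> is \<open>\<Theta>\<close> times a Hardy function, \<open>J\<close> maps the one model space into the other.
  It is onto: for \<open>h\<close> in the model space of \<open>\<Theta>'\<close> put \<open>f = (I - \<Theta>W\<^sup>*) D\<^sub>*\<^sup>-\<^sup>1 h\<close>. Then \<open>Jf = h\<close>, and with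
  \<open>k = D\<^sup>-\<^sup>1(I - W\<^sup>*\<Theta>)g\<close> one has \<open>R\<Theta>Dk = \<Theta>g\<close>, hence \<open>\<langle>f, \<Theta>g\<rangle> = \<langle>h, \<Theta>'k\<rangle> = 0\<close>.

  All this needs the Hardy space to be stable under multiplication by \<open>\<Theta>\<close> and by \<open>R\<close>
  (\<open>hardy_vec_inner\<close>, \<open>hardy_vec_resolvent\<close>). Both facts follow from one principle,
  \<open>hardy_pair_L1_limit\<close>: a function on the disc with square integrable radial limits is in the Hardy
  space as soon as it is the limit of Hardy functions pointwise on the disc and, for the boundary values, in the mean
  on the circle. For products, the partial sums of the Taylor series of one factor are inserted;
  their convergence in the mean square on the circle is \<open>hardy_pair_Parseval\<close>, which is derived
  from Bessel's inequality and from Fatou's lemma along the radial limits, without the completeness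
  of the trigonometric system. For \<open>R\<close> the partial sums of the Neumann series are inserted; they
  converge on the disc because \<open>\<Theta>\<close> is a contraction there (\<open>inner_contraction\<close>), a maximum principle
  that is proved by applying a crude bound to the powers of a Hardy function.

  The defect operators enter only through \<open>D\<^sup>2 = I - W\<^sup>*W\<close>, self-adjointness, invertibility and
  \<open>D\<^sub>*W = WD\<close>. Existence of the square roots is obtained from Brouwer's fixed point theorem;
  uniqueness and the relation \<open>D\<^sub>*W = WD\<close> both follow from the fact that the equation
  \<open>PE + EQ = 0\<close> with positive \<open>P\<close> and positive definite \<open>Q\<close> has only the solution \<open>E = 0\<close>
  (\<open>sylvester_eq_0\<close>).
\<close>


section \<open>Complex matrices and the Hermitian inner product\<close>

lemma cinner_adj: "cinner (A *v x) y = cinner x (adj A *v y)"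
proof -
  have "cinner (A *v x) y = (\<Sum>i\<in>UNIV. \<Sum>j\<in>UNIV. A $ i $ j * x $ j * cnj (y $ i))"
    by (simp add: cinner_def matrix_vector_mult_def sum_distrib_right)
  also have "\<dots> = (\<Sum>j\<in>UNIV. \<Sum>i\<in>UNIV. A $ i $ j * x $ j * cnj (y $ i))"
    by (rule sum.swap)
  also have "\<dots> = cinner x (adj A *v y)"
    by (simp add: cinner_def matrix_vector_mult_def adj_def sum_distrib_left mult_ac)
  finally show ?thesis .
qed

lemma adj_adj [simp]: "adj (adj A) = A"
  by (simp add: adj_def vec_eq_iff)

lemma adj_mult: "adj (A ** B) = adj B ** adj A"
  by (simp add: adj_def vec_eq_iff matrix_matrix_mult_def mult.commute)

lemma adj_add: "adj (A + B) = adj A + adj B"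
  by (simp add: adj_def vec_eq_iff)

lemma adj_diff: "adj (A - B) = adj A - adj B"
  by (simp add: adj_def vec_eq_iff)

lemma adj_mat_1 [simp]: "adj (mat 1) = mat 1"
  by (auto simp: adj_def vec_eq_iff mat_def)

lemma cinner_diff_left: "cinner (x - y) z = cinner x z - cinner y z"
  by (simp add: cinner_def sum_subtractf left_diff_distrib)

lemma cinner_add_right: "cinner x (y + z) = cinner x y + cinner x z"
  by (simp add: cinner_def sum.distrib distrib_left)

lemma cinner_commute: "cinner y x = cnj (cinner x y)"
  by (simp add: cinner_def mult.commute)

lemma cinner_self: "cinner x x = complex_of_real ((norm x)\<^sup>2)"
proof -
  have "(norm x)\<^sup>2 = (\<Sum>i\<in>UNIV. (norm (x $ i))\<^sup>2)"
    by (simp add: norm_vec_def L2_set_def sum_nonneg)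
  then show ?thesis
    by (simp add: cinner_def complex_norm_square del: of_real_power)
qed

lemma Re_cinner: "Re (cinner x y) = x \<bullet> y"
  by (simp add: cinner_def inner_vec_def inner_complex_def)

lemma norm_vector_smult: "norm (c *s (x :: complex ^ 'n)) = norm c * norm x"
  by (simp add: norm_vec_def vector_scalar_mult_def norm_mult L2_set_right_distrib)

lemma cinner_Cauchy_Schwarz: "norm (cinner x y) \<le> norm x * norm y"
proof (cases "cinner x y = 0")
  case False
  define c where "c = cnj (sgn (cinner x y))"
  have c: "norm c = 1" using False by (simp add: c_def norm_sgn)
  have "complex_of_real (norm (cinner x y)) = c * cinner x y"
    using False complex_norm_square[of "cinner x y"]
    by (simp add: c_def sgn_eq field_simps power2_eq_square)
  also have "\<dots> = cinner (c *s x) y"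
    by (simp add: cinner_def sum_distrib_left mult.assoc)
  finally have "norm (cinner x y) = (c *s x) \<bullet> y"
    by (metis Re_cinner Re_complex_of_real)
  also have "\<dots> \<le> norm (c *s x) * norm y" by (rule norm_cauchy_schwarz)
  finally show ?thesis by (simp add: norm_vector_smult c)
qed simp

lemma matrix_add_rdistrib: "(A + B) ** C = A ** C + B ** (C :: complex ^ 'n ^ 'm)"
  by (simp add: vec_eq_iff matrix_matrix_mult_def sum.distrib distrib_right)

lemma matrix_diff_rdistrib: "(A - B) ** C = A ** C - B ** (C :: complex ^ 'n ^ 'm)"
  by (simp add: vec_eq_iff matrix_matrix_mult_def sum_subtractf left_diff_distrib)

lemma matrix_diff_ldistrib: "A ** (B - C) = A ** B - A ** (C :: complex ^ 'n ^ 'm)"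
  by (simp add: vec_eq_iff matrix_matrix_mult_def sum_subtractf right_diff_distrib)

lemma matrix_vector_uminus: "(- A) *v x = - (A *v (x :: complex ^ 'n))"
  by (simp add: vec_eq_iff matrix_vector_mult_def sum_negf)

lemma scaleR_matrix_vector: "(c *\<^sub>R A) *v x = c *\<^sub>R (A *v (x :: complex ^ 'n))"
  by (simp add: vec_eq_iff matrix_vector_mult_def scaleR_sum_right)

lemma norm_matrix_le_opnorm: "norm (A *v x) \<le> opnorm A * norm x"
  unfolding opnorm_def by (rule onorm) simp

lemma opnorm_nonneg: "0 \<le> opnorm A"
  unfolding opnorm_def by (rule onorm_pos_le) simp

lemma norm_adj_le:
  fixes A :: "complex ^ 'd ^ 'd"
  assumes "\<And>x. norm (A *v x) \<le> q * norm x"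
  shows "norm (adj A *v y) \<le> q * norm y"
proof (cases "adj A *v y = 0")
  case False
  have "(norm (adj A *v y))\<^sup>2 = norm (cinner (adj A *v y) (adj A *v y))"
    unfolding cinner_self norm_of_real by simp
  also have "\<dots> = norm (cinner y (A *v (adj A *v y)))"
    by (simp add: cinner_adj)
  also have "\<dots> \<le> norm y * norm (A *v (adj A *v y))"
    by (rule cinner_Cauchy_Schwarz)
  also have "\<dots> \<le> norm y * (q * norm (adj A *v y))"
    by (intro mult_left_mono assms) simp
  finally show ?thesis
    using False by (simp add: power2_eq_square mult_ac)
next
  case True
  have "0 \<le> q * norm y"
    by (rule order_trans[OF norm_ge_zero assms])
  with True show ?thesis by simp
qed

lemma matrix_vector_axis: "((A :: complex ^ 'n ^ 'm) *v axis j 1) $ i = A $ i $ j"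
  by (simp add: matrix_vector_mult_def axis_def if_distrib cong: if_cong)

lemma norm_axis_one: "norm (axis j (1 :: complex) :: complex ^ 'n) = 1"
  by (simp add: norm_vec_def L2_set_def axis_def if_distrib[of norm] if_distrib[of "\<lambda>x. x\<^sup>2"] cong: if_cong)

lemma cinner_axis: "cinner (A *v axis i 1) (axis i 1) = A $ i $ i"
proof -
  have "cinner x (axis i 1) = x $ i" for x :: "complex ^ 'a"
    by (simp add: cinner_def axis_def if_distrib cong: if_cong)
  then show ?thesis by (simp add: matrix_vector_axis)
qed

lemma unitary_norm:
  assumes "unitary_matrix U"
  shows "norm (U *v x) = norm x"
proof -
  have "cinner (U *v x) (U *v x) = cinner x x"
    using assms by (simp add: cinner_adj matrix_vector_mul_assoc unitary_matrix_def)
  then have "(norm (U *v x))\<^sup>2 = (norm x)\<^sup>2"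
    unfolding cinner_self of_real_eq_iff .
  then show ?thesis by simp
qed

lemma cinner_eq_sum: "cinner (A *v x) y = (\<Sum>i\<in>UNIV. \<Sum>j\<in>UNIV. (x $ j * cnj (y $ i)) * A $ i $ j)"
  by (simp add: cinner_def matrix_vector_mult_def sum_distrib_left sum_distrib_right mult_ac)

lemma norm_vec_le_sum: "norm (x :: 'a::real_normed_vector ^ 'n) \<le> (\<Sum>i\<in>UNIV. norm (x $ i))"
  unfolding norm_vec_def by (rule L2_set_le_sum) simp

lemma matrix_eq_0_if_axis: "(\<And>i. E *v axis i 1 = 0) \<Longrightarrow> E = (0 :: complex ^ 'n ^ 'm)"
  by (simp add: matrix_vector_axis vec_eq_iff)

lemma
  assumes "invertible (A :: complex ^ 'n ^ 'm)"
  shows matrix_inv_left: "matrix_inv A ** A = mat 1"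
    and matrix_inv_right: "A ** matrix_inv A = mat 1"
proof -
  have "A ** matrix_inv A = mat 1 \<and> matrix_inv A ** A = mat 1"
    using assms unfolding invertible_def matrix_inv_def by (rule someI_ex)
  then show "matrix_inv A ** A = mat 1" "A ** matrix_inv A = mat 1"
    by auto
qed


section \<open>Positive square roots and defect operators\<close>

lemma trace_congruence:
  "trace (adj E ** P ** E) = (\<Sum>i\<in>UNIV. cinner (P *v (E *v axis i 1)) (E *v axis i 1))"
proof -
  have "trace (adj E ** P ** E) = (\<Sum>i\<in>UNIV. cinner ((adj E ** P ** E) *v axis i 1) (axis i 1))"
    by (simp add: trace_def cinner_axis)
  also have "\<dots> = (\<Sum>i\<in>UNIV. cinner (P *v (E *v axis i 1)) (E *v axis i 1))"
    by (simp add: matrix_vector_mul_assoc[symmetric] cinner_adj[of "adj E"])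
  finally show ?thesis .
qed

text \<open>
  Positive definite matrices: positive ones whose quadratic form vanishes only at \<open>0\<close>.
\<close>

definition posdef_matrix :: "complex ^ 'd ^ 'd \<Rightarrow> bool" where
  "posdef_matrix A \<longleftrightarrow> positive_matrix A \<and> (\<forall>x. cinner (A *v x) x = 0 \<longrightarrow> x = 0)"

text \<open>
  Multiplying the equation by \<open>E\<^sup>*\<close> from the left and taking traces gives
  \<open>tr (E\<^sup>*PE) + tr (EQE\<^sup>*) = 0\<close>, a sum of values of the two quadratic forms, which are nonnegative.
\<close>

lemma sylvester_eq_0:
  fixes P Q E :: "complex ^ 'd ^ 'd"
  assumes P: "positive_matrix P" and Q: "posdef_matrix Q" and eq: "P ** E + E ** Q = 0"
  shows "E = 0"
proof -
  let ?p = "\<lambda>i. cinner (P *v (E *v axis i 1)) (E *v axis i 1)"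
  let ?q = "\<lambda>i. cinner (Q *v (adj E *v axis i 1)) (adj E *v axis i 1)"
  have nn: "0 \<le> Re (?p i)" "0 \<le> Re (?q i)" "?q i = Re (?q i)" for i
    using P Q by (auto simp: posdef_matrix_def positive_matrix_def complex_nonneg_Reals_iff
        complex_eq_iff)
  have "adj E ** P ** E + adj E ** (E ** Q) = adj E ** (P ** E + E ** Q)"
    by (simp add: matrix_add_ldistrib matrix_mul_assoc)
  also have "\<dots> = 0"
    by (simp add: eq)
  finally have "trace (adj E ** P ** E) + trace (adj E ** (E ** Q)) = 0"
    by (metis trace_add trace_0 mat_0)
  also have "trace (adj E ** (E ** Q)) = trace (adj (adj E) ** Q ** adj E)"
    by (subst trace_mul_sym) simp
  finally have "(\<Sum>i\<in>UNIV. ?p i) + (\<Sum>i\<in>UNIV. ?q i) = 0"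
    unfolding trace_congruence .
  then have "(\<Sum>i\<in>UNIV. Re (?p i)) + (\<Sum>i\<in>UNIV. Re (?q i)) = 0"
    by (metis Re_sum plus_complex.simps(1) zero_complex.simps(1))
  moreover have "0 \<le> (\<Sum>i\<in>UNIV. Re (?p i))" "0 \<le> (\<Sum>i\<in>UNIV. Re (?q i))"
    by (auto intro: sum_nonneg nn)
  ultimately have "(\<Sum>i\<in>UNIV. Re (?q i)) = 0"
    by linarith
  then have "Re (?q i) = 0" for i
    by (subst (asm) sum_nonneg_eq_0_iff) (auto intro: nn)
  then have "?q i = 0" for i
    using nn(3)[of i] by simp
  then have "adj E = 0"
    using Q by (intro matrix_eq_0_if_axis) (simp add: posdef_matrix_def)
  then have "adj (adj E) = adj 0"
    by simp
  then show ?thesis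
    by (simp add: adj_def vec_eq_iff)
qed

lemma sqrt_matrix_eqI:
  assumes "posdef_matrix B" and "B ** B = A"
  shows "sqrt_matrix A = B"
  unfolding sqrt_matrix_def
proof (rule the_equality)
  show "positive_matrix B \<and> B ** B = A"
    using assms by (simp add: posdef_matrix_def)
  fix C assume C: "positive_matrix C \<and> C ** C = A"
  have "C ** (C - B) + (C - B) ** B = 0"
    using assms C by (simp add: matrix_diff_ldistrib matrix_diff_rdistrib)
  then have "C - B = 0"
    by (rule sylvester_eq_0[rotated 2]) (use assms C in auto)
  then show "C = B" by simp
qed

text \<open>
  With \<open>B = I - Y\<close>, the equation \<open>B\<^sup>2 = I - X\<close> becomes the fixed point equation \<open>Y = (X + Y\<^sup>2) / 2\<close>.
\<close>

lemma posdef_sqrt_exists: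
  fixes X :: "complex ^ 'd ^ 'd"
  assumes herm: "adj X = X" and q: "0 \<le> q" "q < 1" and X: "\<And>x. norm (X *v x) \<le> q * norm x"
  shows "\<exists>B. adj B = B \<and> posdef_matrix B \<and> B ** B = mat 1 - X"
proof -
  \<comment> \<open>The smaller solution of \<open>(q + \<rho>\<^sup>2) / 2 = \<rho>\<close>: the map below preserves the contractions of norm at most \<open>\<rho>\<close>.\<close>
  define \<rho> where "\<rho> = 1 - sqrt (1 - q)"
  have \<rho>: "0 \<le> \<rho>" "\<rho> < 1" using q by (auto simp: \<rho>_def)
  have "(1 - \<rho>)\<^sup>2 = 1 - q" using q by (simp add: \<rho>_def)
  then have \<rho>2: "(q + \<rho>\<^sup>2) / 2 = \<rho>" by (simp add: power2_eq_square algebra_simps)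
  define S :: "(complex ^ 'd ^ 'd) set"
    where "S = {Y. adj Y = Y \<and> (\<forall>x. norm (Y *v x) \<le> \<rho> * norm x)}"
  define f where "f Y = (1/2) *\<^sub>R (X + Y ** Y)" for Y
  have "0 \<in> S"
    using \<rho> by (simp add: S_def adj_def vec_eq_iff)
  have "closed S"
    unfolding S_def adj_def matrix_vector_mult_def
    by (intro closed_Collect_conj closed_Collect_all closed_Collect_eq closed_Collect_le
        continuous_intros)
  moreover have "bounded S"
  proof (rule boundedI)
    fix Y assume "Y \<in> S"
    have "norm (Y $ i $ j) \<le> \<rho>" for i j
    proof -
      have "norm (Y $ i $ j) = norm ((Y *v axis j 1) $ i)"
        by (simp add: matrix_vector_axis)
      also have "\<dots> \<le> norm (Y *v axis j 1)" by (rule Finite_Cartesian_Product.norm_nth_le)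
      also have "\<dots> \<le> \<rho> * norm (axis j 1 :: complex ^ 'd)" using \<open>Y \<in> S\<close> unfolding S_def by blast
      also have "norm (axis j 1 :: complex ^ 'd) = 1"
        by (rule norm_axis_one)
      finally show ?thesis by simp
    qed
    then show "norm Y \<le> (\<Sum>i\<in>(UNIV :: 'd set). \<Sum>j\<in>(UNIV :: 'd set). \<rho>)"
      by (intro order_trans[OF norm_vec_le_sum] sum_mono)
  qed
  ultimately have "compact S" by (simp add: compact_eq_bounded_closed)
  moreover have "convex S"
  proof (rule convexI)
    fix Y Z and u v :: real
    assume *: "Y \<in> S" "Z \<in> S" "0 \<le> u" "0 \<le> v" "u + v = 1"
    have "norm ((u *\<^sub>R Y + v *\<^sub>R Z) *v x) \<le> \<rho> * norm x" for x
    proof -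
      have "norm ((u *\<^sub>R Y + v *\<^sub>R Z) *v x) = norm (u *\<^sub>R (Y *v x) + v *\<^sub>R (Z *v x))"
        by (simp add: matrix_vector_mult_add_rdistrib scaleR_matrix_vector)
      also have "\<dots> \<le> u * norm (Y *v x) + v * norm (Z *v x)"
        using * by (intro order_trans[OF norm_triangle_ineq]) simp
      also have "\<dots> \<le> u * (\<rho> * norm x) + v * (\<rho> * norm x)"
        using * by (intro add_mono mult_left_mono) (auto simp: S_def)
      also have "\<dots> = \<rho> * norm x" using *(5) by (metis distrib_right mult_1)
      finally show ?thesis .
    qed
    moreover have "adj (u *\<^sub>R Y + v *\<^sub>R Z) = u *\<^sub>R adj Y + v *\<^sub>R adj Z"
      by (simp add: adj_def vec_eq_iff)
    ultimately show "u *\<^sub>R Y + v *\<^sub>R Z \<in> S" using * by (simp add: S_def)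
  qed
  moreover have "S \<noteq> {}" using \<open>0 \<in> S\<close> by auto
  moreover have "continuous_on S f"
    unfolding f_def matrix_matrix_mult_def by (intro continuous_intros)
  moreover have "f \<in> S \<rightarrow> S"
  proof
    fix Y assume Y: "Y \<in> S"
    have "norm (f Y *v x) \<le> \<rho> * norm x" for x
    proof -
      have "norm (f Y *v x) = norm (X *v x + Y *v (Y *v x)) / 2"
        by (simp add: f_def scaleR_matrix_vector matrix_vector_mult_add_rdistrib
            matrix_vector_mul_assoc)
      also have "norm (X *v x + Y *v (Y *v x)) \<le> q * norm x + \<rho> * (\<rho> * norm x)"
      proof (intro norm_triangle_mono X)
        have "norm (Y *v (Y *v x)) \<le> \<rho> * norm (Y *v x)" using Y by (simp add: S_def)
        also have "\<dots> \<le> \<rho> * (\<rho> * norm x)" using Y \<rho> by (intro mult_left_mono) (auto simp: S_def)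
        finally show "norm (Y *v (Y *v x)) \<le> \<rho> * (\<rho> * norm x)" .
      qed
      also have "(q * norm x + \<rho> * (\<rho> * norm x)) / 2 = (q + \<rho>\<^sup>2) / 2 * norm x"
        by (simp add: power2_eq_square field_simps)
      finally show ?thesis by (simp add: \<rho>2)
    qed
    moreover have "adj (f Y) = f Y"
    proof -
      have "adj (f Y) = (1/2) *\<^sub>R adj (X + Y ** Y)"
        by (simp add: f_def adj_def vec_eq_iff)
      also have "\<dots> = f Y" using Y by (simp add: adj_add adj_mult herm f_def S_def)
      finally show ?thesis .
    qed
    ultimately show "f Y \<in> S" by (simp add: S_def)
  qed
  ultimately obtain Y where Y: "Y \<in> S" "f Y = Y"
    by (rule brouwer)
  have "Y + Y = f Y + f Y"
    by (simp only: Y(2))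
  also have "\<dots> = X + Y ** Y"
    unfolding f_def scaleR_left_distrib[symmetric] by simp
  finally have "Y ** Y = Y + Y - X" by simp
  then have "(mat 1 - Y) ** (mat 1 - Y) = mat 1 - X"
    by (simp add: matrix_diff_ldistrib matrix_diff_rdistrib)
  moreover have herm1: "adj (mat 1 - Y) = mat 1 - Y"
    using Y by (simp add: adj_diff S_def)
  moreover have "posdef_matrix (mat 1 - Y)"
  proof -
    have "cnj (cinner ((mat 1 - Y) *v x) x) = cinner ((mat 1 - Y) *v x) x" for x
      by (metis cinner_adj cinner_commute herm1)
    then have im: "Im (cinner ((mat 1 - Y) *v x) x) = 0" for x
      by (simp add: complex_eq_iff)
    have re: "(1 - \<rho>) * (norm x)\<^sup>2 \<le> Re (cinner ((mat 1 - Y) *v x) x)" for x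
    proof -
      have "Re (cinner (Y *v x) x) \<le> norm (Y *v x) * norm x"
        by (meson cinner_Cauchy_Schwarz complex_Re_le_cmod order_trans)
      also have "\<dots> \<le> \<rho> * norm x * norm x"
        using Y by (intro mult_right_mono) (auto simp: S_def)
      finally have "Re (cinner (Y *v x) x) \<le> \<rho> * (norm x)\<^sup>2"
        by (simp add: power2_eq_square mult.assoc)
      moreover have "cinner ((mat 1 - Y) *v x) x = of_real ((norm x)\<^sup>2) - cinner (Y *v x) x"
        by (simp only: matrix_vector_mult_diff_rdistrib cinner_diff_left cinner_self matrix_vector_mul_lid)
      ultimately show ?thesis
        by (simp add: left_diff_distrib)
    qed
    have "x = 0" if "cinner ((mat 1 - Y) *v x) x = 0" for x
    proof -
      have "(1 - \<rho>) * (norm x)\<^sup>2 \<le> 0" using re[of x] that by simp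
      then have "(norm x)\<^sup>2 \<le> 0" using \<rho> by (simp add: mult_le_0_iff)
      then show ?thesis by simp
    qed
    moreover have "0 \<le> Re (cinner ((mat 1 - Y) *v x) x)" for x
      by (rule order_trans[OF _ re]) (use \<rho> in simp)
    ultimately show ?thesis
      using im by (auto simp: posdef_matrix_def positive_matrix_def complex_nonneg_Reals_iff)
  qed
  ultimately show ?thesis by blast
qed

lemma defect_properties:
  assumes q: "0 \<le> q" "q < 1" and W: "\<And>x. norm (W *v x) \<le> q * norm x"
  shows "adj (defect W) = defect W" and "posdef_matrix (defect W)"
    and "defect W ** defect W = mat 1 - adj W ** W"
proof -
  have "norm ((adj W ** W) *v x) \<le> q * q * norm x" for x
  proof -
    have "norm ((adj W ** W) *v x) \<le> q * norm (W *v x)"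
      by (simp add: norm_adj_le[OF W] matrix_vector_mul_assoc[symmetric])
    also have "\<dots> \<le> q * (q * norm x)" by (intro mult_left_mono W q)
    finally show ?thesis by simp
  qed
  moreover have "adj (adj W ** W) = adj W ** W" by (simp add: adj_mult)
  moreover have "0 \<le> q * q" "q * q < 1"
    using q mult_left_le[of q q] by (simp, linarith)
  ultimately obtain B where B: "adj B = B" "posdef_matrix B" "B ** B = mat 1 - adj W ** W"
    using posdef_sqrt_exists[of "adj W ** W" "q * q"] by blast
  then have "defect W = B" unfolding defect_def by (intro sqrt_matrix_eqI)
  with B show "adj (defect W) = defect W" and "posdef_matrix (defect W)"
    and "defect W ** defect W = mat 1 - adj W ** W"
    by auto
qed

text \<open>
  The difference \<open>E\<close> of the two sides satisfies \<open>D\<^sub>*E + ED = D\<^sub>*\<^sup>2W - WD\<^sup>2 = 0\<close>.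
\<close>

lemma defect_intertwining:
  assumes q: "0 \<le> q" "q < 1" and W: "\<And>x. norm (W *v x) \<le> q * norm x"
  shows "defect (adj W) ** W = W ** defect W"
proof -
  note D = defect_properties[OF q W] and D' = defect_properties[OF q norm_adj_le[OF W]]
  have D1: "W ** defect W ** defect W = W - W ** adj W ** W"
    by (simp add: D(3) matrix_diff_ldistrib matrix_mul_assoc[symmetric])
  have D2: "defect (adj W) ** (defect (adj W) ** W) = W - W ** adj W ** W"
    by (simp add: D'(3) matrix_diff_rdistrib matrix_mul_assoc)
  have "defect (adj W) ** (defect (adj W) ** W - W ** defect W)
      + (defect (adj W) ** W - W ** defect W) ** defect W = 0"
    by (simp add: matrix_diff_ldistrib matrix_diff_rdistrib D1 D2 matrix_mul_assoc
        D2[unfolded matrix_mul_assoc])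
  then have "defect (adj W) ** W - W ** defect W = 0"
    by (rule sylvester_eq_0[rotated 2]) (use D D' in \<open>auto simp: posdef_matrix_def\<close>)
  then show ?thesis by simp
qed

lemma posdef_invertible: "posdef_matrix A \<Longrightarrow> invertible A"
proof -
  assume A: "posdef_matrix A"
  have "x = 0" if "A *v x = 0" for x
    using A that by (auto simp: posdef_matrix_def cinner_def)
  then show ?thesis
    by (simp add: invertible_left_inverse matrix_left_invertible_ker)
qed


section \<open>Square integrable functions on the circle\<close>

interpretation circle: finite_measure circle
  by (rule finite_measure_lebesgue_on) simp

interpretation circle: complete_measure circle
proof
  fix A B assume A: "B \<subseteq> A" "A \<in> null_sets circle"
  then have "A \<in> null_sets lebesgue"
    by (subst (asm) null_sets_restrict_space) auto
  then have "B \<in> null_sets lebesgue"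
    using A by (blast intro: completion.complete2)
  moreover have "B \<subseteq> {0..2*pi}"
    using A by (auto simp: null_sets_def sets_restrict_space)
  ultimately show "B \<in> sets circle"
    by (auto simp: sets_restrict_space null_sets_def)
qed

text \<open>
  Since Lebesgue measure on the circle is complete, measurability of boundary functions may be
  checked almost everywhere.
\<close>

lemma measurable_circle_AE:
  fixes f g :: "real \<Rightarrow> 'a::topological_space"
  assumes f: "f \<in> borel_measurable circle" and ae: "AE t in circle. f t = g t"
  shows "g \<in> borel_measurable circle"
proof (rule measurableI)
  fix A :: "'a set" assume A: "A \<in> sets borel"
  show "g -` A \<inter> space circle \<in> sets circle"
  proof (rule circle.in_sets_AE)
    show "AE t in circle. t \<in> f -` A \<inter> space circle \<longleftrightarrow> t \<in> g -` A \<inter> space circle"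
      using ae by eventually_elim auto
    show "f -` A \<inter> space circle \<in> sets circle" using f A by (rule measurable_sets)
  qed simp
qed simp

lemma measurable_circle_lim:
  fixes f :: "nat \<Rightarrow> real \<Rightarrow> 'a::{real_normed_vector,second_countable_topology}"
  assumes f: "\<And>n. f n \<in> borel_measurable circle" and ae: "AE t in circle. (\<lambda>n. f n t) \<longlonglongrightarrow> g t"
  shows "g \<in> borel_measurable circle"
proof -
  obtain N where N: "{t \<in> space circle. \<not> (\<lambda>n. f n t) \<longlonglongrightarrow> g t} \<subseteq> N" "N \<in> null_sets circle"
    using ae by (auto elim: AE_E3 simp: eventually_ae_filter)
  have "(\<lambda>t. indicator (space circle - N) t *\<^sub>R g t) \<in> borel_measurable circle"
  proof (rule borel_measurable_LIMSEQ_metric)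
    show "(\<lambda>t. indicator (space circle - N) t *\<^sub>R f n t) \<in> borel_measurable circle" for n
      using N f[of n] by (intro borel_measurable_scaleR borel_measurable_indicator) auto
    show "(\<lambda>n. indicator (space circle - N) t *\<^sub>R f n t)
        \<longlonglongrightarrow> indicator (space circle - N) t *\<^sub>R g t" if "t \<in> space circle" for t
      using N that by (auto simp: indicator_def)
  qed
  moreover have "AE t in circle. indicator (space circle - N) t *\<^sub>R g t = g t"
    using AE_not_in[OF N(2)] AE_space by eventually_elim simp
  ultimately show ?thesis by (rule measurable_circle_AE)
qed

lemma continuous_measurable_circle:
  "continuous_on UNIV f \<Longrightarrow> f \<in> borel_measurable circle"
  by (intro continuous_imp_measurable_on_sets_lebesgue) (auto intro: continuous_on_subset)

lemma cis_measurable [measurable]: "(\<lambda>t. cis (c * t)) \<in> borel_measurable circle"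
  by (intro continuous_measurable_circle continuous_intros)

lemma L2_measurable: "u \<in> L2_circle \<Longrightarrow> u \<in> borel_measurable circle"
  by (simp add: L2_circle_def)

lemma L2_integrable_norm2: "u \<in> L2_circle \<Longrightarrow> integrable circle (\<lambda>t. (norm (u t))\<^sup>2)"
  by (simp add: L2_circle_def)

lemma L2_integrable:
  assumes "u \<in> L2_circle"
  shows "integrable circle u"
proof (rule Bochner_Integration.integrable_bound)
  show "integrable circle (\<lambda>t. 1 + (norm (u t))\<^sup>2)"
    using assms by (auto simp: L2_circle_def)
  have "x \<le> 1 + x\<^sup>2" if "0 \<le> x" for x :: real
    using that sum_power2_ge_zero[of "x - 1" x] by (simp add: power2_eq_square algebra_simps)
  then show "AE t in circle. norm (u t) \<le> norm (1 + (norm (u t))\<^sup>2)"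
    by (intro AE_I2) simp
qed (use assms in \<open>auto simp: L2_circle_def\<close>)

lemma L2_bound:
  fixes u :: "real \<Rightarrow> 'a::euclidean_space"
  assumes "u \<in> borel_measurable circle" "integrable circle g" "AE t in circle. (norm (u t))\<^sup>2 \<le> g t"
  shows "u \<in> L2_circle"
proof -
  have "integrable circle (\<lambda>t. (norm (u t))\<^sup>2)"
    by (rule Bochner_Integration.integrable_bound[OF assms(2)])
      (use assms(1,3) in \<open>auto elim!: eventually_mono\<close>)
  then show ?thesis using assms by (simp add: L2_circle_def)
qed

lemma square_norm_add_le: "(norm (a + b))\<^sup>2 \<le> 2 * (norm a)\<^sup>2 + 2 * (norm b)\<^sup>2"
proof -
  have "(norm (a + b))\<^sup>2 \<le> (norm a + norm b)\<^sup>2"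
    by (intro power_mono norm_triangle_ineq norm_ge_zero)
  also have "\<dots> \<le> 2 * (norm a)\<^sup>2 + 2 * (norm b)\<^sup>2"
    using sum_power2_ge_zero[of "norm a - norm b" 0] by (simp add: power2_eq_square algebra_simps)
  finally show ?thesis .
qed

lemma L2_add:
  assumes "u \<in> L2_circle" "v \<in> L2_circle"
  shows "(\<lambda>t. u t + v t) \<in> L2_circle"
proof (rule L2_bound)
  show "integrable circle (\<lambda>t. 2 * (norm (u t))\<^sup>2 + 2 * (norm (v t))\<^sup>2)"
    using assms by (auto simp: L2_circle_def)
qed (use assms in \<open>auto simp: L2_circle_def square_norm_add_le\<close>)

lemma L2_mult_bounded:
  fixes u v :: "real \<Rightarrow> complex"
  assumes "u \<in> borel_measurable circle" "AE t in circle. norm (u t) \<le> B" "v \<in> L2_circle"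
  shows "(\<lambda>t. u t * v t) \<in> L2_circle"
proof (rule L2_bound)
  show "integrable circle (\<lambda>t. B\<^sup>2 * (norm (v t))\<^sup>2)"
    using assms by (auto simp: L2_circle_def)
  show "AE t in circle. (norm (u t * v t))\<^sup>2 \<le> B\<^sup>2 * (norm (v t))\<^sup>2"
    using assms(2)
    by eventually_elim (auto simp: norm_mult power_mult_distrib intro!: mult_right_mono power_mono)
qed (use assms in \<open>auto simp: L2_circle_def\<close>)

lemma L2_cmult: "u \<in> L2_circle \<Longrightarrow> (\<lambda>t. c * u t :: complex) \<in> L2_circle"
  by (rule L2_mult_bounded[of "\<lambda>_. c" "norm c"]) auto

lemma L2_diff:
  fixes u v :: "real \<Rightarrow> complex"
  assumes "u \<in> L2_circle" "v \<in> L2_circle"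
  shows "(\<lambda>t. u t - v t) \<in> L2_circle"
  using L2_add[OF assms(1) L2_cmult[OF assms(2), of "-1"]] by simp

lemma L2_cis_mult: "u \<in> L2_circle \<Longrightarrow> (\<lambda>t. cis (c * t) * u t) \<in> L2_circle"
  by (rule L2_mult_bounded[where B = 1]) auto

lemma L2_mult_integrable:
  fixes u v :: "real \<Rightarrow> complex"
  assumes "u \<in> L2_circle" "v \<in> L2_circle"
  shows "integrable circle (\<lambda>t. u t * v t)"
proof (rule Bochner_Integration.integrable_bound)
  show "integrable circle (\<lambda>t. (norm (u t))\<^sup>2 + (norm (v t))\<^sup>2)"
    using assms by (auto simp: L2_circle_def)
  have "a * b \<le> a\<^sup>2 + b\<^sup>2" for a b :: real
    using sum_squares_ge_zero[of a b] sum_squares_ge_zero[of "a - b" 0]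
    unfolding power2_eq_square left_diff_distrib right_diff_distrib mult.commute[of b a]
    by linarith
  then show "AE t in circle. norm (u t * v t) \<le> norm ((norm (u t))\<^sup>2 + (norm (v t))\<^sup>2)"
    by (intro AE_I2) (simp add: norm_mult)
qed (use assms in \<open>auto simp: L2_circle_def\<close>)

lemma L2_cnj: "u \<in> L2_circle \<Longrightarrow> (\<lambda>t. cnj (u t)) \<in> L2_circle"
  unfolding L2_circle_def using measurable_compose[OF _ borel_measurable_continuous_onI[OF continuous_on_cnj[OF continuous_on_id]]]
  by (auto simp: o_def)

lemma L2_Cauchy_Schwarz:
  fixes u v :: "real \<Rightarrow> complex"
  assumes u: "u \<in> L2_circle" and v: "v \<in> L2_circle"
  shows "(LINT t|circle. norm (u t * v t))\<^sup>2
    \<le> (LINT t|circle. (norm (u t))\<^sup>2) * (LINT t|circle. (norm (v t))\<^sup>2)"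
proof -
  note [measurable] = u[THEN L2_measurable] v[THEN L2_measurable]
  have "(\<integral>\<^sup>+t. ennreal (norm (u t)) * ennreal (norm (v t)) \<partial>circle)\<^sup>2
    \<le> (\<integral>\<^sup>+t. (ennreal (norm (u t)))\<^sup>2 \<partial>circle) * (\<integral>\<^sup>+t. (ennreal (norm (v t)))\<^sup>2 \<partial>circle)"
    by (rule Cauchy_Schwarz_nn_integral) measurable
  also have "(\<integral>\<^sup>+t. ennreal (norm (u t)) * ennreal (norm (v t)) \<partial>circle)
    = ennreal (LINT t|circle. norm (u t * v t))"
    using integrable_norm[OF L2_mult_integrable[OF u v]]
    by (subst nn_integral_eq_integral[symmetric]) (auto simp: norm_mult ennreal_mult)
  also have "(\<integral>\<^sup>+t. (ennreal (norm (u t)))\<^sup>2 \<partial>circle) = ennreal (LINT t|circle. (norm (u t))\<^sup>2)"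
    using L2_integrable_norm2[OF u]
    by (subst nn_integral_eq_integral[symmetric]) (auto simp: ennreal_power)
  also have "(\<integral>\<^sup>+t. (ennreal (norm (v t)))\<^sup>2 \<partial>circle) = ennreal (LINT t|circle. (norm (v t))\<^sup>2)"
    using L2_integrable_norm2[OF v]
    by (subst nn_integral_eq_integral[symmetric]) (auto simp: ennreal_power)
  finally show ?thesis
    by (simp add: ennreal_power ennreal_mult[symmetric] integral_nonneg_AE)
qed


section \<open>Fourier coefficients and trigonometric polynomials\<close>

text \<open>Fourier coefficients of scalar functions.\<close>

abbreviation fc :: "(real \<Rightarrow> complex) \<Rightarrow> int \<Rightarrow> complex" where
  "fc \<equiv> fourier_coeff (*)"

lemma L2_fc_integrable: "u \<in> L2_circle \<Longrightarrow> integrable circle (\<lambda>t. cis (- (of_int n * t)) * u t)"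
  using L2_integrable[OF L2_cis_mult[of u "- of_int n"]] by simp

lemma fc_add: "u \<in> L2_circle \<Longrightarrow> v \<in> L2_circle \<Longrightarrow> fc (\<lambda>t. u t + v t) n = fc u n + fc v n"
  by (simp add: fourier_coeff_def distrib_left L2_fc_integrable scaleR_right_distrib)

lemma fc_diff: "u \<in> L2_circle \<Longrightarrow> v \<in> L2_circle \<Longrightarrow> fc (\<lambda>t. u t - v t) n = fc u n - fc v n"
  by (simp add: fourier_coeff_def right_diff_distrib L2_fc_integrable scaleR_right_diff_distrib)

lemma fc_cmult: "fc (\<lambda>t. c * u t) n = c * fc u n"
  by (simp add: fourier_coeff_def mult.left_commute[of _ c])

lemma fc_cong_AE:
  assumes "u \<in> borel_measurable circle" "v \<in> borel_measurable circle" "AE t in circle. u t = v t"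
  shows "fc u n = fc v n"
proof -
  have [measurable]: "(\<lambda>t. cis (- (of_int n * t))) \<in> borel_measurable circle"
    using cis_measurable[of "- of_int n"] by simp
  show ?thesis
    unfolding fourier_coeff_def
    by (intro arg_cong[where f = "(*\<^sub>R) _"] integral_cong_AE) (use assms in \<open>auto elim: eventually_mono\<close>)
qed

lemma norm_fc_le:
  assumes "u \<in> L2_circle"
  shows "norm (fc u n) \<le> (1 / (2 * pi)) * (LINT t|circle. norm (u t))"
proof -
  have "norm (LINT t|circle. cis (- (of_int n * t)) * u t)
      \<le> (LINT t|circle. norm (cis (- (of_int n * t)) * u t))"
    by (rule integral_norm_bound)
  then show ?thesis by (simp add: fourier_coeff_def norm_mult divide_right_mono)
qed

lemma fc_shift: "fc (\<lambda>t. cis t * u t) n = fc u (n - 1)"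
proof -
  have "cis (- (of_int n * t)) * (cis t * u t) = cis (- (of_int (n - 1) * t)) * u t" for t
    by (simp add: mult.assoc[symmetric] cis_mult left_diff_distrib)
  then show ?thesis unfolding fourier_coeff_def by (simp only:)
qed

lemma integral_cis: "(LINT t|circle. cis (of_int n * t)) = (if n = 0 then 2 * pi else 0)"
proof -
  have "(LINT t|circle. cis (of_int n * t)) = integral {0..2*pi} (\<lambda>t. cis (of_int n * t))"
    by (rule lebesgue_integral_eq_integral)
      (auto intro!: continuous_imp_integrable_real continuous_intros)
  also have "\<dots> = (if n = 0 then 2 * pi else 0)"
  proof (cases "n = 0")
    case False
    have "((\<lambda>t. cis (of_int n * t)) has_integral
        cis (of_int n * (2*pi)) / (\<i> * of_int n) - cis (of_int n * 0) / (\<i> * of_int n)) {0..2*pi}"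
    proof (rule fundamental_theorem_of_calculus)
      fix x :: real
      have "((\<lambda>t. cis (of_int n * t)) has_vector_derivative (of_int n *\<^sub>R (\<i> * cis (of_int n * x))))
          (at x within {0..2*pi})"
        unfolding has_vector_derivative_def
        by (rule has_derivative_eq_rhs[OF has_derivative_cis[OF has_derivative_mult_right[OF has_derivative_ident]]])
          (simp add: fun_eq_iff scaleR_conv_of_real)
      then have "((\<lambda>t. cis (of_int n * t) / (\<i> * of_int n)) has_vector_derivative
          (of_int n *\<^sub>R (\<i> * cis (of_int n * x))) / (\<i> * of_int n)) (at x within {0..2*pi})"
        by (rule has_vector_derivative_divide)
      then show "((\<lambda>t. cis (of_int n * t) / (\<i> * of_int n)) has_vector_derivative cis (of_int n * x))
          (at x within {0..2*pi})"
        using False by (simp add: scaleR_conv_of_real)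
    qed simp
    moreover have "cis (of_int n * (2*pi)) = 1"
      by (metis cis_multiple_2pi Ints_of_int mult.commute)
    ultimately show ?thesis using False by (simp add: integral_unique)
  qed (simp add: scaleR_conv_of_real)
  finally show ?thesis .
qed

lemma L2_zero: "(\<lambda>_. 0) \<in> L2_circle"
  by (simp add: L2_circle_def)

lemma L2_sum:
  fixes u :: "'i \<Rightarrow> real \<Rightarrow> 'a::euclidean_space"
  shows "(\<And>i. i \<in> I \<Longrightarrow> u i \<in> L2_circle) \<Longrightarrow> (\<lambda>t. \<Sum>i\<in>I. u i t) \<in> L2_circle"
  by (induction I rule: infinite_finite_induct) (simp_all add: L2_zero L2_add)

lemma L2_cis: "(\<lambda>t. cis (c * t)) \<in> L2_circle"
  by (simp add: L2_circle_def)

lemma integral_norm_trig_poly: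
  "(LINT t|circle. (norm (\<Sum>k<N. a k * cis (real k * t)))\<^sup>2) = 2 * pi * (\<Sum>k<N. (norm (a k))\<^sup>2)"
proof -
  have int: "integrable circle (\<lambda>t. cis (of_int n * t))" for n
    by (rule L2_integrable[OF L2_cis])
  have "complex_of_real (LINT t|circle. (norm (\<Sum>k<N. a k * cis (real k * t)))\<^sup>2)
      = (LINT t|circle. of_real ((norm (\<Sum>k<N. a k * cis (real k * t)))\<^sup>2))"
    by (rule integral_complex_of_real[symmetric])
  also have "\<dots> = (LINT t|circle. (\<Sum>k<N. \<Sum>l<N. (a k * cnj (a l)) * cis (of_int (int k - int l) * t)))"
    by (intro Bochner_Integration.integral_cong refl)
      (simp add: complex_norm_square sum_product cis_cnj cis_mult mult_ac right_diff_distrib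
        del: of_real_power)
  also have "\<dots> = (\<Sum>k<N. \<Sum>l<N. (a k * cnj (a l)) * (if int k - int l = 0 then 2 * pi else 0))"
    by (simp only: integral_cis[symmetric] Bochner_Integration.integral_sum int
        Bochner_Integration.integrable_sum integrable_mult_right integral_mult_right_zero)
  also have "\<dots> = (\<Sum>k<N. \<Sum>l<N. of_real (if l = k then 2 * pi * (norm (a k))\<^sup>2 else 0))"
    by (intro sum.cong refl) (auto simp: complex_norm_square simp del: of_real_power)
  also have "\<dots> = of_real (2 * pi * (\<Sum>k<N. (norm (a k))\<^sup>2))"
    unfolding of_real_sum[symmetric] by (simp add: sum_distrib_left)
  finally show ?thesis by (simp only: of_real_eq_iff)
qed

text \<open>The trigonometric polynomial with coefficients \<open>a 0, \<dots>, a (N - 1)\<close>.\<close>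

abbreviation trig_poly :: "(nat \<Rightarrow> complex) \<Rightarrow> nat \<Rightarrow> real \<Rightarrow> complex" where
  "trig_poly a N t \<equiv> (\<Sum>k<N. a k * cis (real k * t))"

lemma L2_trig_poly: "trig_poly a N \<in> L2_circle"
  by (intro L2_sum L2_cmult L2_cis)

lemma integral_norm_diff_partial_sum:
  assumes u: "u \<in> L2_circle"
  shows "(LINT t|circle. (norm (u t - trig_poly (\<lambda>k. fc u (int k)) N t))\<^sup>2)
    = (LINT t|circle. (norm (u t))\<^sup>2) - 2 * pi * (\<Sum>k<N. (norm (fc u (int k)))\<^sup>2)"
proof -
  let ?p = "trig_poly (\<lambda>k. fc u (int k)) N"
  let ?S = "\<Sum>k<N. (norm (fc u (int k)))\<^sup>2"
  have intp: "integrable circle (\<lambda>t. u t * cnj (?p t))"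
    by (intro L2_mult_integrable u L2_cnj L2_trig_poly)
  have "(LINT t|circle. u t * cnj (?p t))
      = (LINT t|circle. (\<Sum>k<N. cnj (fc u (int k)) * (cis (- (of_int (int k) * t)) * u t)))"
    by (intro Bochner_Integration.integral_cong refl)
      (simp add: sum_distrib_left cis_cnj mult_ac)
  also have "\<dots> = (\<Sum>k<N. cnj (fc u (int k)) * (LINT t|circle. cis (- (of_int (int k) * t)) * u t))"
    by (simp only: Bochner_Integration.integral_sum L2_fc_integrable[OF u] integrable_mult_right
        integral_mult_right_zero)
  also have "\<dots> = (\<Sum>k<N. cnj (fc u (int k)) * (2 * pi * fc u (int k)))"
    by (simp add: fourier_coeff_def scaleR_conv_of_real)
  also have "\<dots> = of_real (2 * pi * ?S)"
    unfolding of_real_mult of_real_sum sum_distrib_left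
    by (intro sum.cong refl) (simp add: complex_norm_square mult_ac del: of_real_power)
  finally have cross: "(LINT t|circle. Re (u t * cnj (?p t))) = 2 * pi * ?S"
    using intp by (simp only: integral_Re Re_complex_of_real)
  have intp': "integrable circle (\<lambda>t. Re (u t * cnj (?p t)))"
    using intp by (rule integrable_Re)
  have eq: "(norm (x - y))\<^sup>2 = (norm x)\<^sup>2 - 2 * Re (x * cnj y) + (norm y)\<^sup>2" for x y :: complex
    unfolding cmod_power2 by (simp add: power2_eq_square algebra_simps)
  have "(LINT t|circle. (norm (u t - ?p t))\<^sup>2)
     = (LINT t|circle. (norm (u t))\<^sup>2) - 2 * (LINT t|circle. Re (u t * cnj (?p t)))
       + (LINT t|circle. (norm (?p t))\<^sup>2)"
    unfolding eq using intp' L2_integrable_norm2[OF u] L2_integrable_norm2[OF L2_trig_poly]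
    by (simp only: Bochner_Integration.integral_add Bochner_Integration.integral_diff
        Bochner_Integration.integrable_diff integral_mult_right_zero integrable_mult_right)
  then show ?thesis unfolding cross integral_norm_trig_poly by simp
qed


section \<open>Scalar Hardy functions\<close>

text \<open>
  The function \<open>f\<close> on the disc belongs to the scalar Hardy space and \<open>u\<close> represents its boundary
  function. Compared with \<^const>\<open>hardy2\<close>, the boundary function is an explicit argument that is determined
  only up to null sets; this makes the closure properties below easy to state.
\<close>

definition hardy_pair :: "(complex \<Rightarrow> complex) \<Rightarrow> (real \<Rightarrow> complex) \<Rightarrow> bool" where
  "hardy_pair f u \<longleftrightarrow>
     (AE t in circle. ((\<lambda>r. f (of_real r * cis t)) \<longlongrightarrow> u t) (at_left 1)) \<and>
     u \<in> L2_circle \<and> (\<forall>n<0. fc u n = 0) \<and>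
     (\<forall>z\<in>ball 0 1. (\<lambda>n. z ^ n * fc u (int n)) sums f z)"

lemma hardy_pairD:
  assumes "hardy_pair f u"
  shows "AE t in circle. ((\<lambda>r. f (of_real r * cis t)) \<longlongrightarrow> u t) (at_left 1)"
    and "u \<in> L2_circle" and "n < 0 \<Longrightarrow> fc u n = 0"
    and "norm z < 1 \<Longrightarrow> (\<lambda>n. z ^ n * fc u (int n)) sums f z"
  using assms by (auto simp: hardy_pair_def)

lemma hardy_pair_cong_AE:
  assumes "hardy_pair f u" "AE t in circle. u t = v t"
  shows "hardy_pair f v"
proof -
  note D = hardy_pairD[OF assms(1)]
  have v: "v \<in> borel_measurable circle"
    by (rule measurable_circle_AE[OF L2_measurable[OF D(2)] assms(2)])
  have "v \<in> L2_circle"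
    by (rule L2_bound[OF v L2_integrable_norm2[OF D(2)]]) (use assms(2) in \<open>auto elim: eventually_mono\<close>)
  moreover have "fc v n = fc u n" for n
    by (rule fc_cong_AE[symmetric]) (use D(2) v assms(2) in \<open>auto simp: L2_measurable\<close>)
  moreover have "AE t in circle. ((\<lambda>r. f (of_real r * cis t)) \<longlongrightarrow> v t) (at_left 1)"
    using D(1) assms(2) by eventually_elim simp
  ultimately show ?thesis using D by (simp add: hardy_pair_def)
qed

lemma hardy_pair_zero: "hardy_pair (\<lambda>_. 0) (\<lambda>_. 0)"
  by (simp add: hardy_pair_def L2_zero fourier_coeff_def)

lemma hardy_pair_add:
  assumes "hardy_pair f u" "hardy_pair g v"
  shows "hardy_pair (\<lambda>z. f z + g z) (\<lambda>t. u t + v t)"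
proof -
  note D = hardy_pairD[OF assms(1)] hardy_pairD[OF assms(2)]
  have "AE t in circle. ((\<lambda>r. f (of_real r * cis t) + g (of_real r * cis t)) \<longlongrightarrow> u t + v t) (at_left 1)"
    using D(1,5) by eventually_elim (rule tendsto_add)
  then show ?thesis
    using D by (auto simp: hardy_pair_def L2_add fc_add distrib_left intro!: sums_add)
qed

lemma hardy_pair_cmult:
  assumes "hardy_pair f u"
  shows "hardy_pair (\<lambda>z. c * f z) (\<lambda>t. c * u t)"
proof -
  note D = hardy_pairD[OF assms(1)]
  have "AE t in circle. ((\<lambda>r. c * f (of_real r * cis t)) \<longlongrightarrow> c * u t) (at_left 1)"
    using D(1) by eventually_elim (rule tendsto_mult_left)
  then show ?thesis
    using D by (auto simp: hardy_pair_def L2_cmult fc_cmult mult.left_commute[of _ c] intro!: sums_mult)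
qed

lemma hardy_pair_sum:
  "(\<And>i. i \<in> I \<Longrightarrow> hardy_pair (f i) (u i)) \<Longrightarrow> hardy_pair (\<lambda>z. \<Sum>i\<in>I. f i z) (\<lambda>t. \<Sum>i\<in>I. u i t)"
  by (induction I rule: infinite_finite_induct) (simp_all add: hardy_pair_zero hardy_pair_add)

lemma radial_at_left: "((\<lambda>r. of_real r * cis t) \<longlongrightarrow> cis t) (at_left 1)"
proof -
  have "((\<lambda>r. of_real r * cis t) \<longlongrightarrow> of_real 1 * cis t) (at_left 1)"
    by (intro tendsto_intros)
  then show ?thesis by simp
qed

lemma hardy_pair_shift:
  assumes "hardy_pair f u"
  shows "hardy_pair (\<lambda>z. z * f z) (\<lambda>t. cis t * u t)"
proof -
  note D = hardy_pairD[OF assms(1)]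
  have "AE t in circle. ((\<lambda>r. of_real r * cis t * f (of_real r * cis t)) \<longlongrightarrow> cis t * u t) (at_left 1)"
    using D(1) by eventually_elim (intro tendsto_mult radial_at_left)
  moreover have "(\<lambda>t. cis t * u t) \<in> L2_circle"
    using L2_cis_mult[OF D(2), of 1] by simp
  moreover have "(\<lambda>n. z ^ n * fc (\<lambda>t. cis t * u t) (int n)) sums (z * f z)" if "norm z < 1" for z
  proof -
    have "(\<lambda>n. z ^ Suc n * fc (\<lambda>t. cis t * u t) (int (Suc n))) sums (z * f z)"
      using sums_mult[OF D(4)[OF that], of z] by (simp add: fc_shift mult.assoc)
    then show ?thesis
      by (subst (asm) sums_Suc_iff) (simp add: fc_shift D(3))
  qed
  ultimately show ?thesis
    using D(3) by (auto simp: hardy_pair_def fc_shift)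
qed

lemma hardy_pair_poly_mult:
  assumes "hardy_pair f u"
  shows "hardy_pair (\<lambda>z. (\<Sum>k<N. a k * z ^ k) * f z) (\<lambda>t. trig_poly a N t * u t)"
proof -
  have *: "hardy_pair (\<lambda>z. z ^ k * f z) (\<lambda>t. cis (real k * t) * u t)" for k
  proof (induction k)
    case (Suc k)
    have "(\<lambda>t. cis (real (Suc k) * t) * u t) = (\<lambda>t. cis t * (cis (real k * t) * u t))"
      by (simp add: fun_eq_iff mult.assoc[symmetric] cis_mult distrib_right)
    moreover have "(\<lambda>z. z ^ Suc k * f z) = (\<lambda>z. z * (z ^ k * f z))"
      by (simp add: fun_eq_iff mult.assoc)
    ultimately show ?case using hardy_pair_shift[OF Suc] by (simp only:)
  qed (use assms in simp)
  have "hardy_pair (\<lambda>z. \<Sum>k<N. a k * (z ^ k * f z)) (\<lambda>t. \<Sum>k<N. a k * (cis (real k * t) * u t))"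
    by (intro hardy_pair_sum hardy_pair_cmult *)
  then show ?thesis by (simp add: sum_distrib_right mult.assoc)
qed

text \<open>
  The Fourier coefficients of \<open>u N\<close> converge to those of \<open>v\<close> uniformly, which allows the passage to the
  limit in the Taylor series at each point of the disc.
\<close>

lemma hardy_pair_L1_limit:
  assumes fu: "\<And>N. hardy_pair (f N) (u N)"
    and lim: "\<And>z. norm z < 1 \<Longrightarrow> (\<lambda>N. f N z) \<longlonglongrightarrow> g z"
    and rad: "AE t in circle. ((\<lambda>r. g (of_real r * cis t)) \<longlongrightarrow> v t) (at_left 1)"
    and v: "v \<in> L2_circle"
    and L1: "(\<lambda>N. LINT t|circle. norm (u N t - v t)) \<longlonglongrightarrow> 0"
  shows "hardy_pair g v"
proof -
  define e where "e N = (1 / (2 * pi)) * (LINT t|circle. norm (u N t - v t))" for N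
  have e: "e \<longlonglongrightarrow> 0"
    unfolding e_def by (rule tendsto_mult_right_zero[OF L1])
  have le: "norm (fc (u N) n - fc v n) \<le> e N" for N n
    using norm_fc_le[of "\<lambda>t. u N t - v t" n] fu[of N] v
    by (simp add: hardy_pair_def L2_diff fc_diff e_def)
  have fclim: "(\<lambda>N. fc (u N) n) \<longlonglongrightarrow> fc v n" for n
    by (subst LIM_zero_iff[symmetric]) (rule Lim_null_comparison[OF always_eventually e], use le in blast)
  have "fc v n = 0" if "n < 0" for n
    using fclim[of n] hardy_pairD(3)[OF fu that] by (simp add: LIMSEQ_const_iff)
  moreover have "(\<lambda>n. z ^ n * fc v (int n)) sums g z" if z: "norm z < 1" for z
  proof -
    have bound: "norm (z ^ n * (fc (u N) (int n) - fc v (int n))) \<le> norm z ^ n * e N" for n N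
      by (simp add: norm_mult norm_power le mult_left_mono)
    have geo: "summable (\<lambda>n. norm z ^ n * e N)" for N
      using z by (intro summable_mult2 summable_geometric) simp
    have sd: "summable (\<lambda>n. z ^ n * (fc (u N) (int n) - fc v (int n)))" for N
      by (rule summable_comparison_test'[OF geo]) (rule bound)
    have sv: "summable (\<lambda>n. z ^ n * fc v (int n))"
    proof -
      have "summable (\<lambda>n. z ^ n * fc (u 0) (int n) - z ^ n * (fc (u 0) (int n) - fc v (int n)))"
        by (intro summable_diff sd sums_summable[OF hardy_pairD(4)[OF fu z]])
      then show ?thesis by (simp add: right_diff_distrib)
    qed
    have "norm (f N z - (\<Sum>n. z ^ n * fc v (int n))) \<le> e N / (1 - norm z)" for N
    proof -
      have "f N z - (\<Sum>n. z ^ n * fc v (int n)) = (\<Sum>n. z ^ n * (fc (u N) (int n) - fc v (int n)))"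
        using hardy_pairD(4)[OF fu[of N] z] sv
        by (simp add: right_diff_distrib suminf_diff[symmetric] sums_iff)
      also have "norm \<dots> \<le> (\<Sum>n. norm z ^ n * e N)"
        by (rule norm_suminf_le[OF bound geo])
      also have "\<dots> = e N / (1 - norm z)"
        using z by (simp add: suminf_mult2[symmetric] suminf_geometric summable_geometric)
      finally show ?thesis .
    qed
    then have "(\<lambda>N. f N z - (\<Sum>n. z ^ n * fc v (int n))) \<longlonglongrightarrow> 0"
      by (intro Lim_null_comparison[OF always_eventually tendsto_divide_zero[OF e]]) blast
    then have "(\<lambda>N. f N z) \<longlonglongrightarrow> (\<Sum>n. z ^ n * fc v (int n))"
      by (simp add: LIM_zero_iff)
    then have "g z = (\<Sum>n. z ^ n * fc v (int n))"
      using lim[OF z] LIMSEQ_unique by blast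
    then show ?thesis using sv by (simp add: summable_sums)
  qed
  ultimately show ?thesis using rad v by (simp add: hardy_pair_def)
qed

lemma Fatou_L2:
  assumes meas: "\<And>n. w n \<in> borel_measurable circle"
    and lim: "AE t in circle. (\<lambda>n. w n t) \<longlonglongrightarrow> (v t :: complex)"
    and bound: "\<And>n. (\<integral>\<^sup>+t. ennreal ((norm (w n t))\<^sup>2) \<partial>circle) \<le> B"
  shows "(\<integral>\<^sup>+t. ennreal ((norm (v t))\<^sup>2) \<partial>circle) \<le> B"
proof -
  have "(\<integral>\<^sup>+t. ennreal ((norm (v t))\<^sup>2) \<partial>circle)
      = (\<integral>\<^sup>+t. liminf (\<lambda>n. ennreal ((norm (w n t))\<^sup>2)) \<partial>circle)"
  proof (rule nn_integral_cong_AE, use lim in eventually_elim)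
    fix t assume "(\<lambda>n. w n t) \<longlonglongrightarrow> v t"
    then have "(\<lambda>n. ennreal ((norm (w n t))\<^sup>2)) \<longlonglongrightarrow> ennreal ((norm (v t))\<^sup>2)"
      by (intro tendsto_intros)
    then show "ennreal ((norm (v t))\<^sup>2) = liminf (\<lambda>n. ennreal ((norm (w n t))\<^sup>2))"
      by (rule lim_imp_Liminf[OF sequentially_bot, symmetric])
  qed
  also have "\<dots> \<le> liminf (\<lambda>n. \<integral>\<^sup>+t. ennreal ((norm (w n t))\<^sup>2) \<partial>circle)"
    by (rule nn_integral_liminf) (use meas in measurable)
  also have "\<dots> \<le> liminf (\<lambda>n. B)"
    by (intro Liminf_mono always_eventually allI bound)
  finally show ?thesis by (simp add: Liminf_const)
qed

lemma Bessel:
  assumes "u \<in> L2_circle"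
  shows "2 * pi * (\<Sum>k<N. (norm (fc u (int k)))\<^sup>2) \<le> (LINT t|circle. (norm (u t))\<^sup>2)"
proof -
  have "0 \<le> (LINT t|circle. (norm (u t - trig_poly (\<lambda>k. fc u (int k)) N t))\<^sup>2)"
    by (rule integral_nonneg_AE) simp
  then show ?thesis using integral_norm_diff_partial_sum[OF assms, of N] by simp
qed

lemma filterlim_radii: "filterlim (\<lambda>n. 1 - inverse (real (Suc n))) (at_left 1) sequentially"
proof (subst filterlim_at, intro conjI)
  show "\<forall>\<^sub>F n in sequentially. 1 - inverse (real (Suc n)) \<in> {..<1} \<and> 1 - inverse (real (Suc n)) \<noteq> 1"
    by (simp del: of_nat_Suc)
  show "(\<lambda>n. 1 - inverse (real (Suc n))) \<longlonglongrightarrow> 1"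
    using tendsto_diff[OF tendsto_const[of 1] LIMSEQ_inverse_real_of_nat] by simp
qed

text \<open>
  By Bessel's inequality and the Pythagorean identity for partial sums, it is enough to show that
  \<open>\<integral> \<bar>u\<bar>\<^sup>2 \<le> 2\<pi> \<Sum> \<bar>c\<^sub>k\<bar>\<^sup>2\<close>. Fatou's lemma is applied twice: to the Taylor polynomials on the circle of
  radius \<open>r < 1\<close>, and to the functions \<open>t \<mapsto> f (r e\<^sup>i\<^sup>t)\<close> as \<open>r\<close> tends to \<open>1\<close>.
\<close>

lemma hardy_pair_Parseval:
  assumes "hardy_pair f u"
  shows "(\<lambda>N. LINT t|circle. (norm (u t - trig_poly (\<lambda>k. fc u (int k)) N t))\<^sup>2) \<longlonglongrightarrow> 0"
proof -
  note D = hardy_pairD[OF assms]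
  define c where "c k = fc u (int k)" for k
  define C where "C = (\<Sum>k. (norm (c k))\<^sup>2)"
  have summ: "summable (\<lambda>k. (norm (c k))\<^sup>2)"
  proof (rule summableI_nonneg_bounded)
    show "(\<Sum>k<N. (norm (c k))\<^sup>2) \<le> (LINT t|circle. (norm (u t))\<^sup>2) / (2 * pi)" for N
      using Bessel[OF D(2), of N] by (simp add: c_def field_simps)
  qed simp
  have poly: "(\<integral>\<^sup>+t. ennreal ((norm (trig_poly a N t))\<^sup>2) \<partial>circle) \<le> ennreal (2 * pi * C)"
    if "\<And>k. norm (a k) \<le> norm (c k)" for a N
  proof -
    have "(\<integral>\<^sup>+t. ennreal ((norm (trig_poly a N t))\<^sup>2) \<partial>circle) = ennreal (2 * pi * (\<Sum>k<N. (norm (a k))\<^sup>2))"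
      by (subst nn_integral_eq_integral[OF L2_integrable_norm2[OF L2_trig_poly]])
        (simp_all add: integral_norm_trig_poly)
    also have "\<dots> \<le> ennreal (2 * pi * (\<Sum>k<N. (norm (c k))\<^sup>2))"
      using that by (intro ennreal_leI mult_left_mono sum_mono power_mono) auto
    also have "\<dots> \<le> ennreal (2 * pi * C)"
      unfolding C_def by (intro ennreal_leI mult_left_mono sum_le_suminf summ) auto
    finally show ?thesis .
  qed
  have lim_r: "(\<lambda>N. trig_poly (\<lambda>k. of_real r ^ k * c k) N t) \<longlonglongrightarrow> f (of_real r * cis t)"
    if "0 \<le> r" "r < 1" for r t
    using D(4)[of "of_real r * cis t"] that
    by (simp add: sums_def c_def norm_mult power_mult_distrib Complex.DeMoivre mult_ac)
  have meas_r: "(\<lambda>t. f (of_real r * cis t)) \<in> borel_measurable circle" if "0 \<le> r" "r < 1" for r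
    by (rule measurable_circle_lim[OF L2_measurable[OF L2_trig_poly] AE_I2[OF lim_r[OF that]]])
  have int_r: "(\<integral>\<^sup>+t. ennreal ((norm (f (of_real r * cis t)))\<^sup>2) \<partial>circle) \<le> ennreal (2 * pi * C)"
    if "0 \<le> r" "r < 1" for r
  proof (rule Fatou_L2[OF L2_measurable[OF L2_trig_poly]])
    show "AE t in circle. (\<lambda>N. trig_poly (\<lambda>k. of_real r ^ k * c k) N t) \<longlonglongrightarrow> f (of_real r * cis t)"
      using lim_r[OF that] by simp
    show "(\<integral>\<^sup>+t. ennreal ((norm (trig_poly (\<lambda>k. of_real r ^ k * c k) N t))\<^sup>2) \<partial>circle) \<le> ennreal (2 * pi * C)" for N
      by (rule poly) (use that in \<open>auto simp: norm_mult norm_power power_le_one intro: mult_left_le_one_le\<close>)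
  qed
  have rn: "0 \<le> 1 - inverse (real (Suc n))" "1 - inverse (real (Suc n)) < 1" for n
    by (auto simp: field_simps)
  have "(\<integral>\<^sup>+t. ennreal ((norm (u t))\<^sup>2) \<partial>circle) \<le> ennreal (2 * pi * C)"
  proof (rule Fatou_L2)
    show "(\<lambda>t. f (of_real (1 - inverse (real (Suc n))) * cis t)) \<in> borel_measurable circle" for n
      by (rule meas_r[OF rn])
    show "AE t in circle. (\<lambda>n. f (of_real (1 - inverse (real (Suc n))) * cis t)) \<longlonglongrightarrow> u t"
      using D(1) by eventually_elim (rule filterlim_compose[OF _ filterlim_radii])
  qed (rule int_r[OF rn])
  moreover have "(\<integral>\<^sup>+t. ennreal ((norm (u t))\<^sup>2) \<partial>circle) = ennreal (LINT t|circle. (norm (u t))\<^sup>2)"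
    by (rule nn_integral_eq_integral[OF L2_integrable_norm2[OF D(2)]]) simp
  moreover have "0 \<le> C" unfolding C_def by (intro suminf_nonneg summ) simp
  ultimately have le: "(LINT t|circle. (norm (u t))\<^sup>2) \<le> 2 * pi * C"
    by (simp add: ennreal_le_iff)
  have "(\<lambda>N. 2 * pi * (C - (\<Sum>k<N. (norm (c k))\<^sup>2))) \<longlonglongrightarrow> 2 * pi * (C - C)"
    unfolding C_def by (intro tendsto_intros summable_LIMSEQ summ)
  then have lim0: "(\<lambda>N. 2 * pi * (C - (\<Sum>k<N. (norm (c k))\<^sup>2))) \<longlonglongrightarrow> 0" by simp
  show ?thesis
  proof (rule tendsto_sandwich[OF _ _ tendsto_const lim0]; intro always_eventually allI)
    show "0 \<le> (LINT t|circle. (norm (u t - trig_poly (\<lambda>k. fc u (int k)) N t))\<^sup>2)" for N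
      by (rule integral_nonneg_AE) simp
    show "(LINT t|circle. (norm (u t - trig_poly (\<lambda>k. fc u (int k)) N t))\<^sup>2)
        \<le> 2 * pi * (C - (\<Sum>k<N. (norm (c k))\<^sup>2))" for N
      using le by (simp add: integral_norm_diff_partial_sum[OF D(2)] c_def right_diff_distrib)
  qed
qed

lemma hardy_pair_mult:
  assumes fu: "hardy_pair f u" and gv: "hardy_pair g v" and B: "AE t in circle. norm (u t) \<le> B"
  shows "hardy_pair (\<lambda>z. f z * g z) (\<lambda>t. u t * v t)"
proof (rule hardy_pair_L1_limit)
  note D = hardy_pairD[OF fu] and E = hardy_pairD[OF gv]
  let ?p = "trig_poly (\<lambda>k. fc u (int k))"
  show "hardy_pair (\<lambda>z. (\<Sum>k<N. fc u (int k) * z ^ k) * g z) (\<lambda>t. ?p N t * v t)" for N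
    by (rule hardy_pair_poly_mult[OF gv])
  show "(\<lambda>N. (\<Sum>k<N. fc u (int k) * z ^ k) * g z) \<longlonglongrightarrow> f z * g z" if "norm z < 1" for z
    using D(4)[OF that] by (intro tendsto_mult_right) (simp add: sums_def mult.commute)
  show "AE t in circle. ((\<lambda>r. f (of_real r * cis t) * g (of_real r * cis t)) \<longlongrightarrow> u t * v t) (at_left 1)"
    using D(1) E(1) by eventually_elim (rule tendsto_mult)
  show "(\<lambda>t. u t * v t) \<in> L2_circle"
    by (rule L2_mult_bounded[OF L2_measurable[OF D(2)] B E(2)])
  let ?V = "LINT t|circle. (norm (v t))\<^sup>2"
  have lim: "(\<lambda>N. sqrt ((LINT t|circle. (norm (u t - ?p N t))\<^sup>2) * ?V)) \<longlonglongrightarrow> 0"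
    using tendsto_real_sqrt[OF tendsto_mult_left_zero[OF hardy_pair_Parseval[OF fu], of ?V]] by simp
  show "(\<lambda>N. LINT t|circle. norm (?p N t * v t - u t * v t)) \<longlonglongrightarrow> 0"
  proof (rule tendsto_sandwich[OF _ _ tendsto_const lim]; intro always_eventually allI)
    fix N
    show "0 \<le> (LINT t|circle. norm (?p N t * v t - u t * v t))"
      by (rule integral_nonneg_AE) simp
    have "(LINT t|circle. norm (?p N t * v t - u t * v t)) = (LINT t|circle. norm ((u t - ?p N t) * v t))"
      by (simp only: left_diff_distrib norm_minus_commute)
    also have "\<dots> \<le> sqrt ((LINT t|circle. (norm (u t - ?p N t))\<^sup>2) * ?V)"
      by (rule real_le_rsqrt[OF L2_Cauchy_Schwarz[OF L2_diff[OF D(2) L2_trig_poly] E(2)]])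
    finally show "(LINT t|circle. norm (?p N t * v t - u t * v t))
        \<le> sqrt ((LINT t|circle. (norm (u t - ?p N t))\<^sup>2) * ?V)" .
  qed
qed

lemma hardy_pair_crude_bound:
  assumes fu: "hardy_pair f u" and B: "AE t in circle. norm (u t) \<le> B" and z: "norm z < 1"
  shows "norm (f z) \<le> B / (1 - norm z)"
proof -
  note D = hardy_pairD[OF fu]
  have "norm (fc u n) \<le> B" for n
  proof -
    have "(LINT t|circle. norm (u t)) \<le> (LINT t|circle. B)"
      by (rule integral_mono_AE[OF integrable_norm[OF L2_integrable[OF D(2)]] _ B]) simp
    also have "\<dots> = 2 * pi * B" by (simp add: measure_restrict_space)
    finally have "(1 / (2 * pi)) * (LINT t|circle. norm (u t)) \<le> (1 / (2 * pi)) * (2 * pi * B)"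
      by (rule mult_left_mono) simp
    then show ?thesis using norm_fc_le[OF D(2), of n] by simp
  qed
  then have bound: "norm (z ^ n * fc u (int n)) \<le> norm z ^ n * B" for n
    by (simp add: norm_mult norm_power mult_left_mono)
  have "norm (\<Sum>n. z ^ n * fc u (int n)) \<le> (\<Sum>n. norm z ^ n * B)"
    by (rule norm_suminf_le[OF bound]) (use z in \<open>intro summable_mult2 summable_geometric, simp\<close>)
  then show ?thesis
    using D(4)[OF z] z by (simp add: sums_iff suminf_mult2[symmetric] suminf_geometric summable_geometric)
qed

text \<open>
  The maximum principle: the crude bound for \<open>f ^ n\<close> is \<open>B ^ n / (1 - \<bar>z\<bar>)\<close>, and the constant disappears
  on taking \<open>n\<close>-th roots.
\<close>

lemma hardy_pair_bound:
  assumes fu: "hardy_pair f u" and B: "AE t in circle. norm (u t) \<le> B" and z: "norm z < 1"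
    and "0 \<le> B"
  shows "norm (f z) \<le> B"
proof (rule ccontr)
  assume "\<not> norm (f z) \<le> B"
  then have less: "B < norm (f z)" by simp
  have B_pow: "AE t in circle. norm (u t ^ n) \<le> B ^ n" for n
    using B by eventually_elim (simp add: norm_power power_mono)
  have pow: "hardy_pair (\<lambda>z. f z ^ Suc n) (\<lambda>t. u t ^ Suc n)" for n
  proof (induction n)
    case (Suc n)
    show ?case using hardy_pair_mult[OF fu Suc B] by simp
  qed (use fu in simp)
  have le: "(norm (f z) / B) ^ Suc n \<le> 1 / (1 - norm z)" if "B > 0" for n
    using hardy_pair_crude_bound[OF pow B_pow z, of n] that z
    by (simp add: norm_power norm_mult power_divide divide_simps mult_ac del: power_Suc)
  show False
  proof (cases "B = 0")
    case True
    then show False using hardy_pair_crude_bound[OF fu B z] less by simp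
  next
    case False
    then have "B > 0" using \<open>0 \<le> B\<close> by simp
    obtain n where "1 / (1 - norm z) < (norm (f z) / B) ^ n"
      using real_arch_pow[of "norm (f z) / B" "1 / (1 - norm z)"] less \<open>B > 0\<close> by auto
    also have "\<dots> \<le> (norm (f z) / B) ^ Suc n"
      using less \<open>B > 0\<close> by (intro power_increasing) auto
    finally show False using le[OF \<open>B > 0\<close>, of n] by simp
  qed
qed


section \<open>Vector-valued Hardy functions and model spaces\<close>

lemma fourier_coeff_bounded_linear:
  assumes sc: "bounded_bilinear sc" and p: "bounded_linear p" and psc: "\<And>c v. p (sc c v) = c * p v"
    and u: "u \<in> L2_circle"
  shows "fc (\<lambda>t. p (u t)) n = p (fourier_coeff sc u n)"
proof -
  interpret sc: bounded_bilinear sc by (rule sc)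
  interpret p: bounded_linear p by (rule p)
  obtain K where K: "\<And>a b. norm (sc a b) \<le> norm a * norm b * K"
    using sc.bounded by blast
  have [measurable]: "u \<in> borel_measurable circle" using u by (rule L2_measurable)
  have [measurable]: "(\<lambda>t. cis (- (of_int n * t))) \<in> borel_measurable circle"
    using cis_measurable[of "- of_int n"] by simp
  have "integrable circle (\<lambda>t. sc (cis (- (of_int n * t))) (u t))"
  proof (rule Bochner_Integration.integrable_bound)
    show "integrable circle (\<lambda>t. norm (u t) * K)"
      by (intro integrable_mult_left integrable_norm L2_integrable u)
    show "(\<lambda>t. sc (cis (- (of_int n * t))) (u t)) \<in> borel_measurable circle"
      by (rule borel_measurable_continuous_Pair) (auto intro!: continuous_intros sc.continuous_on)
    show "AE t in circle. norm (sc (cis (- (of_int n * t))) (u t)) \<le> norm (norm (u t) * K)"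
    proof (rule AE_I2)
      fix t
      have "norm (sc (cis (- (of_int n * t))) (u t)) \<le> norm (u t) * K"
        using K[of "cis (- (of_int n * t))" "u t"] by simp
      then show "norm (sc (cis (- (of_int n * t))) (u t)) \<le> norm (norm (u t) * K)"
        by simp
    qed
  qed
  from integral_bounded_linear[OF p this] show ?thesis
    by (simp add: fourier_coeff_def p.scaleR psc)
qed

text \<open>
  A complex-linear functional of a Hardy function is a scalar Hardy function. It is used for the
  coordinates of vectors and for the entries of matrices.
\<close>

lemma hardy2_component:
  assumes sc: "bounded_bilinear sc" and p: "bounded_linear p" and psc: "\<And>c v. p (sc c v) = c * p v"
    and F: "hardy2 sc F"
  shows "hardy_pair (\<lambda>z. p (F z)) (\<lambda>t. p (boundary F t))"
proof -
  interpret p: bounded_linear p by (rule p)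
  obtain K where K: "\<And>v. norm (p v) \<le> norm v * K"
    using p.bounded by blast
  have u: "boundary F \<in> L2_circle" using F by (simp add: hardy2_def)
  note coeff = fourier_coeff_bounded_linear[OF sc p psc u]
  have "AE t in circle. ((\<lambda>r. p (F (of_real r * cis t))) \<longlongrightarrow> p (boundary F t)) (at_left 1)"
    using F unfolding hardy2_def by (auto elim!: eventually_mono intro: p.tendsto)
  moreover have "(\<lambda>t. p (boundary F t)) \<in> L2_circle"
  proof (rule L2_bound)
    show "(\<lambda>t. p (boundary F t)) \<in> borel_measurable circle"
      by (rule measurable_compose[OF L2_measurable[OF u]])
        (intro borel_measurable_continuous_onI p.continuous_on continuous_intros)
    show "integrable circle (\<lambda>t. K\<^sup>2 * (norm (boundary F t))\<^sup>2)"
      by (intro integrable_mult_right L2_integrable_norm2 u)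
    have "(norm (p v))\<^sup>2 \<le> K\<^sup>2 * (norm v)\<^sup>2" for v
      using power_mono[OF K[of v], of 2] by (simp add: power_mult_distrib mult.commute)
    then show "AE t in circle. (norm (p (boundary F t)))\<^sup>2 \<le> K\<^sup>2 * (norm (boundary F t))\<^sup>2"
      by simp
  qed
  moreover have "fc (\<lambda>t. p (boundary F t)) n = 0" if "n < 0" for n
    using F that by (simp add: hardy2_def coeff p.zero)
  moreover have "(\<lambda>n. z ^ n * fc (\<lambda>t. p (boundary F t)) (int n)) sums p (F z)" if "z \<in> ball 0 1" for z
  proof -
    have "(\<lambda>n. sc (z ^ n) (fourier_coeff sc (boundary F) (int n))) sums F z"
      using F that by (simp add: hardy2_def)
    from p.sums[OF this] show ?thesis by (simp add: coeff psc)
  qed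
  ultimately show ?thesis by (simp add: hardy_pair_def)
qed

lemma bounded_bilinear_vector_smult: "bounded_bilinear ((*s) :: complex \<Rightarrow> complex ^ 'n \<Rightarrow> complex ^ 'n)"
proof
  show "\<exists>K. \<forall>a b. norm (a *s (b :: complex ^ 'n)) \<le> norm a * norm b * K"
    by (intro exI[of _ 1]) (simp add: norm_vector_smult)
qed (simp_all add: vec_eq_iff algebra_simps)

lemma bounded_bilinear_smult_matrix:
  "bounded_bilinear (smult_matrix :: complex \<Rightarrow> complex ^ 'n ^ 'm \<Rightarrow> complex ^ 'n ^ 'm)"
proof
  have "smult_matrix a b = (\<chi> i. a *s (b $ i))" for a and b :: "complex ^ 'n ^ 'm"
    by (simp add: smult_matrix_def vec_eq_iff)
  then have "norm (smult_matrix a b) = norm a * norm b" for a and b :: "complex ^ 'n ^ 'm"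
    by (simp add: norm_vec_def[where 'b = 'm] norm_vector_smult L2_set_right_distrib)
  then show "\<exists>K. \<forall>a b. norm (smult_matrix a (b :: complex ^ 'n ^ 'm)) \<le> norm a * norm b * K"
    by (intro exI[of _ 1]) simp
qed (simp_all add: vec_eq_iff smult_matrix_def algebra_simps)

lemma hardy_pair_cong_disc:
  assumes "hardy_pair f u" and eq: "\<And>z. norm z < 1 \<Longrightarrow> f z = g z"
  shows "hardy_pair g u"
proof -
  note D = hardy_pairD[OF assms(1)]
  have ev: "\<forall>\<^sub>F r in at_left 1. f (of_real r * cis t) = g (of_real r * cis t)" for t
    using eventually_at_left_real[of "0::real" 1]
    by (rule eventually_mono) (auto intro!: eq simp: norm_mult)
  have "AE t in circle. ((\<lambda>r. g (of_real r * cis t)) \<longlongrightarrow> u t) (at_left 1)"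
    using D(1) by eventually_elim (subst tendsto_cong[OF ev, symmetric])
  then show ?thesis using D eq by (simp add: hardy_pair_def)
qed

text \<open>
  The vector-valued analogue of \<^const>\<open>hardy_pair\<close>, by coordinates. Values of \<open>F\<close> outside the open disc
  play no role.
\<close>

definition hardy_vec :: "(complex \<Rightarrow> complex ^ 'd) \<Rightarrow> (real \<Rightarrow> complex ^ 'd) \<Rightarrow> bool" where
  "hardy_vec F U \<longleftrightarrow> (\<forall>i. hardy_pair (\<lambda>z. F z $ i) (\<lambda>t. U t $ i))"

lemma hardy2_hardy_vec: "hardy2 (*s) F \<Longrightarrow> hardy_vec F (boundary F)"
  unfolding hardy_vec_def
  by (intro allI hardy2_component[OF bounded_bilinear_vector_smult bounded_linear_vec_nth]) auto

lemma hardy_vec_L2: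
  assumes "hardy_vec F U"
  shows "U \<in> L2_circle"
proof -
  have comp: "(\<lambda>t. U t $ i) \<in> L2_circle" for i
    using assms by (auto simp: hardy_vec_def hardy_pair_def)
  show ?thesis
  proof (rule L2_bound)
    have "(\<lambda>t. U t \<bullet> b) \<in> borel_measurable circle" if "b \<in> Basis" for b
      using that L2_measurable[OF comp] by (auto simp: Basis_vec_def inner_axis)
    then show "U \<in> borel_measurable circle"
      by (subst borel_measurable_euclidean_space) blast
    show "integrable circle (\<lambda>t. \<Sum>i\<in>UNIV. (norm (U t $ i))\<^sup>2)"
      by (intro Bochner_Integration.integrable_sum L2_integrable_norm2 comp)
    show "AE t in circle. (norm (U t))\<^sup>2 \<le> (\<Sum>i\<in>UNIV. (norm (U t $ i))\<^sup>2)"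
      by (simp add: norm_vec_def L2_set_def sum_nonneg)
  qed
qed

lemma hardy_vec_radial:
  assumes "hardy_vec F U"
  shows "AE t in circle. ((\<lambda>r. F (of_real r * cis t)) \<longlongrightarrow> U t) (at_left 1)"
proof -
  have "AE t in circle. \<forall>i\<in>UNIV. ((\<lambda>r. F (of_real r * cis t) $ i) \<longlongrightarrow> U t $ i) (at_left 1)"
    using assms by (subst AE_ball_countable) (auto simp: hardy_vec_def hardy_pair_def intro: countable_finite)
  then show ?thesis by eventually_elim (auto intro: vec_tendstoI)
qed

lemma hardy_vec_boundary:
  assumes "hardy_vec F U"
  shows "AE t in circle. boundary F t = U t"
  using hardy_vec_radial[OF assms] unfolding boundary_def
  by eventually_elim (rule tendsto_Lim, simp_all)

lemma hardy_vec_hardy2: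
  assumes FU: "hardy_vec F U"
  shows "hardy2 (*s) F"
proof -
  note b = hardy_vec_boundary[OF FU]
  have meas: "boundary F \<in> borel_measurable circle"
    using b by (intro measurable_circle_AE[OF L2_measurable[OF hardy_vec_L2[OF FU]]]) (auto elim: eventually_mono)
  have L2: "boundary F \<in> L2_circle"
    by (rule L2_bound[OF meas L2_integrable_norm2[OF hardy_vec_L2[OF FU]]])
      (use b in \<open>auto elim: eventually_mono\<close>)
  have comp: "hardy_pair (\<lambda>z. F z $ i) (\<lambda>t. boundary F t $ i)" for i
    by (rule hardy_pair_cong_AE[of _ "\<lambda>t. U t $ i"])
      (use FU b in \<open>auto simp: hardy_vec_def elim: eventually_mono\<close>)
  have coeff: "fc (\<lambda>t. boundary F t $ i) n = fourier_coeff (*s) (boundary F) n $ i" for i n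
    by (rule fourier_coeff_bounded_linear[OF bounded_bilinear_vector_smult bounded_linear_vec_nth _ L2]) simp
  have "AE t in circle. ((\<lambda>r. F (of_real r * cis t)) \<longlongrightarrow> boundary F t) (at_left 1)"
    using hardy_vec_radial[OF FU] b by eventually_elim simp
  moreover have "fourier_coeff (*s) (boundary F) n = 0" if "n < 0" for n
    using hardy_pairD(3)[OF comp that] by (simp add: vec_eq_iff coeff)
  moreover have "(\<lambda>n. z ^ n *s fourier_coeff (*s) (boundary F) (int n)) sums F z" if "z \<in> ball 0 1" for z
    unfolding sums_def
  proof (rule vec_tendstoI)
    show "(\<lambda>N. (\<Sum>n<N. z ^ n *s fourier_coeff (*s) (boundary F) (int n)) $ i) \<longlonglongrightarrow> F z $ i" for i
      using hardy_pairD(4)[OF comp, of z i] that by (simp add: sums_def coeff)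
  qed
  ultimately show ?thesis using L2 by (simp add: hardy2_def)
qed

lemma H2_iff: "F \<in> H2 \<longleftrightarrow> hardy_vec F (boundary F) \<and> (\<forall>z. z \<notin> ball 0 1 \<longrightarrow> F z = 0)"
  unfolding H2_def using hardy2_hardy_vec hardy_vec_hardy2 by blast

lemma H2_I: "hardy_vec F U \<Longrightarrow> (\<And>z. z \<notin> ball 0 1 \<Longrightarrow> F z = 0) \<Longrightarrow> F \<in> H2"
  unfolding H2_def using hardy_vec_hardy2 by blast

lemma cinner_integrable:
  assumes "hardy_vec F U" "hardy_vec G V"
  shows "integrable circle (\<lambda>t. cinner (U t) (V t))"
  unfolding cinner_def using assms
  by (intro Bochner_Integration.integrable_sum L2_mult_integrable L2_cnj)
    (auto simp: hardy_vec_def hardy_pair_def)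

lemma H2_inner_eq:
  assumes FU: "hardy_vec F U" and GV: "hardy_vec G V"
  shows "H2_inner F G = (1 / (2 * pi)) *\<^sub>R (LINT t|circle. cinner (U t) (V t))"
proof -
  have "(LINT t|circle. cinner (boundary F t) (boundary G t)) = (LINT t|circle. cinner (U t) (V t))"
  proof (rule integral_cong_AE)
    show "AE t in circle. cinner (boundary F t) (boundary G t) = cinner (U t) (V t)"
      using hardy_vec_boundary[OF FU] hardy_vec_boundary[OF GV] by eventually_elim simp
    have "hardy_vec F (boundary F)" "hardy_vec G (boundary G)"
      using FU GV by (auto intro: hardy2_hardy_vec hardy_vec_hardy2)
    then show "(\<lambda>t. cinner (boundary F t) (boundary G t)) \<in> borel_measurable circle"
      by (intro borel_measurable_integrable cinner_integrable)
    show "(\<lambda>t. cinner (U t) (V t)) \<in> borel_measurable circle"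
      by (intro borel_measurable_integrable cinner_integrable[OF FU GV])
  qed
  then show ?thesis by (simp add: H2_inner_def)
qed

lemma hardy_vec_add: "hardy_vec F U \<Longrightarrow> hardy_vec G V \<Longrightarrow> hardy_vec (\<lambda>z. F z + G z) (\<lambda>t. U t + V t)"
  by (simp add: hardy_vec_def hardy_pair_add)

lemma hardy_vec_zero: "hardy_vec (\<lambda>_. 0) (\<lambda>_. 0)"
  by (simp add: hardy_vec_def hardy_pair_zero)

lemma hardy_vec_matrix: "hardy_vec F U \<Longrightarrow> hardy_vec (\<lambda>z. A *v F z) (\<lambda>t. A *v U t)"
  by (auto simp: hardy_vec_def matrix_vector_mult_def intro!: hardy_pair_sum hardy_pair_cmult)

lemma hardy_vec_cong_disc:
  "hardy_vec F U \<Longrightarrow> (\<And>z. norm z < 1 \<Longrightarrow> F z = G z) \<Longrightarrow> hardy_vec G U"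
  unfolding hardy_vec_def by (blast intro: hardy_pair_cong_disc[where f = "\<lambda>z. F z $ _"] arg_cong[where f = "\<lambda>x. x $ _"])

text \<open>
  Orthogonality to \<open>\<Theta>H\<^sup>2\<close> expressed by integrals over the circle. The Hardy functions \<open>G\<close> need not vanish
  outside the disc, and \<open>V\<close> may be any representative of the boundary function.
\<close>

lemma model_space_iff:
  assumes mult: "\<And>G V. hardy_vec G V \<Longrightarrow> hardy_vec (\<lambda>z. \<Theta> z *v G z) (\<lambda>t. T t *v V t)"
  shows "f \<in> model_space \<Theta> \<longleftrightarrow>
    f \<in> H2 \<and> (\<forall>G V. hardy_vec G V \<longrightarrow> (LINT t|circle. cinner (boundary f t) (T t *v V t)) = 0)"
    (is "?l \<longleftrightarrow> ?r")
proof
  assume l: ?l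
  then have f: "f \<in> H2" by (simp add: model_space_def)
  moreover have "(LINT t|circle. cinner (boundary f t) (T t *v V t)) = 0" if GV: "hardy_vec G V" for G V
  proof -
    define G0 where "G0 z = (if z \<in> ball 0 1 then G z else 0)" for z
    have G0: "hardy_vec G0 V"
      by (rule hardy_vec_cong_disc[OF GV]) (simp add: G0_def)
    then have "G0 \<in> H2" by (rule H2_I) (simp add: G0_def)
    then have "H2_inner f (\<lambda>z. \<Theta> z *v G0 z) = 0" using l by (simp add: model_space_def)
    then show ?thesis
      using H2_inner_eq[OF _ mult[OF G0], of f "boundary f"] f by (simp add: H2_iff)
  qed
  ultimately show ?r by blast
next
  assume r: ?r
  then show ?l
    unfolding model_space_def using H2_inner_eq[OF _ mult, of f "boundary f"] by (auto simp: H2_iff)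
qed


section \<open>Resolvents of strict contractions and Neumann series\<close>

text \<open>
  Partial sums of the Neumann series: \<open>neumann B y N\<close> is \<open>y + By + \<dots> + B\<^bsup>N-1\<^esup>y\<close>, written by Horner's scheme.
\<close>

primrec neumann :: "complex ^ 'd ^ 'd \<Rightarrow> complex ^ 'd \<Rightarrow> nat \<Rightarrow> complex ^ 'd" where
  "neumann B y 0 = 0"
| "neumann B y (Suc N) = y + B *v neumann B y N"

context
  fixes B :: "complex ^ 'd ^ 'd" and q :: real
  assumes B: "\<And>x. norm (B *v x) \<le> q * norm x" and q: "0 \<le> q" "q < 1"
begin

lemma one_minus_lower: "(1 - q) * norm x \<le> norm ((mat 1 - B) *v x)"
proof -
  have "norm x - norm (B *v x) \<le> norm ((mat 1 - B) *v x)"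
    by (simp add: matrix_vector_mult_diff_rdistrib norm_triangle_ineq2)
  then show ?thesis using B[of x] by (simp add: left_diff_distrib)
qed

lemma one_minus_invertible: "invertible (mat 1 - B)"
proof -
  have "x = 0" if "(mat 1 - B) *v x = 0" for x
    using one_minus_lower[of x] that q by (simp add: mult_le_0_iff)
  then show ?thesis
    by (simp add: invertible_left_inverse matrix_left_invertible_ker)
qed

lemma norm_resolvent_le: "norm (matrix_inv (mat 1 - B) *v y) \<le> norm y / (1 - q)"
  using one_minus_lower[of "matrix_inv (mat 1 - B) *v y"] q
  by (simp add: matrix_vector_mul_assoc matrix_inv_right[OF one_minus_invertible] field_simps)

lemma resolvent_fixpoint:
  "matrix_inv (mat 1 - B) *v y = y + B *v (matrix_inv (mat 1 - B) *v y)"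
proof -
  have "(mat 1 - B) *v (matrix_inv (mat 1 - B) *v y) = y"
    by (simp add: matrix_vector_mul_assoc matrix_inv_right[OF one_minus_invertible])
  then show ?thesis by (simp add: matrix_vector_mult_diff_rdistrib diff_eq_eq)
qed

lemma neumann_error:
  "norm (neumann B y N - matrix_inv (mat 1 - B) *v y) \<le> q ^ N * (norm y / (1 - q))"
proof (induction N)
  case 0
  show ?case using norm_resolvent_le[of y] by simp
next
  case (Suc N)
  have "neumann B y (Suc N) - matrix_inv (mat 1 - B) *v y
      = B *v (neumann B y N - matrix_inv (mat 1 - B) *v y)"
    by (subst resolvent_fixpoint) (simp add: matrix_vector_mult_diff_distrib)
  then have "norm (neumann B y (Suc N) - matrix_inv (mat 1 - B) *v y)
      \<le> q * norm (neumann B y N - matrix_inv (mat 1 - B) *v y)"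
    using B by simp
  also have "\<dots> \<le> q * (q ^ N * (norm y / (1 - q)))"
    by (intro mult_left_mono Suc q)
  finally show ?case by (simp add: mult_ac)
qed

lemma neumann_tendsto: "(\<lambda>N. neumann B y N) \<longlonglongrightarrow> matrix_inv (mat 1 - B) *v y"
proof -
  have "(\<lambda>N. q ^ N * (norm y / (1 - q))) \<longlonglongrightarrow> 0"
    using q by (intro tendsto_mult_left_zero LIMSEQ_realpow_zero) auto
  then have "(\<lambda>N. neumann B y N - matrix_inv (mat 1 - B) *v y) \<longlonglongrightarrow> 0"
    by (rule Lim_null_comparison[rotated]) (intro always_eventually allI neumann_error)
  then show ?thesis by (simp add: LIM_zero_iff)
qed

end

lemma tendsto_matrix_vector:
  fixes A :: "'b \<Rightarrow> complex ^ 'n ^ 'm"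
  assumes "(A \<longlongrightarrow> A0) F" "(y \<longlongrightarrow> y0) F"
  shows "((\<lambda>x. A x *v y x) \<longlongrightarrow> A0 *v y0) F"
  unfolding matrix_vector_mult_def by (intro tendsto_intros assms)

text \<open>
  Joint continuity of \<open>(B, y) \<mapsto> (I - B)\<^sup>-\<^sup>1 y\<close> on contractions with a common bound \<open>q < 1\<close>.
\<close>

lemma resolvent_tendsto:
  fixes B :: "'b \<Rightarrow> complex ^ 'd ^ 'd"
  assumes B: "(B \<longlongrightarrow> B0) F" and y: "(y \<longlongrightarrow> y0) F" and q: "0 \<le> q" "q < 1"
    and bound: "\<forall>\<^sub>F r in F. \<forall>x. norm (B r *v x) \<le> q * norm x"
    and bound0: "\<And>x. norm (B0 *v x) \<le> q * norm x"
  shows "((\<lambda>r. matrix_inv (mat 1 - B r) *v y r) \<longlongrightarrow> matrix_inv (mat 1 - B0) *v y0) F"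
proof -
  define v where "v = matrix_inv (mat 1 - B0) *v y0"
  have v: "(mat 1 - B0) *v v = y0"
    by (simp add: v_def matrix_vector_mul_assoc matrix_inv_right[OF one_minus_invertible[OF bound0 q]])
  have "((\<lambda>r. norm (y r - (mat 1 - B r) *v v) / (1 - q)) \<longlongrightarrow> norm (y0 - (mat 1 - B0) *v v) / (1 - q)) F"
    using q by (intro tendsto_intros tendsto_matrix_vector B y) auto
  then have lim: "((\<lambda>r. norm (y r - (mat 1 - B r) *v v) / (1 - q)) \<longlongrightarrow> 0) F"
    by (simp add: v)
  have "((\<lambda>r. matrix_inv (mat 1 - B r) *v y r - v) \<longlongrightarrow> 0) F"
  proof (rule Lim_null_comparison[OF _ lim])
    show "\<forall>\<^sub>F r in F. norm (matrix_inv (mat 1 - B r) *v y r - v) \<le> norm (y r - (mat 1 - B r) *v v) / (1 - q)"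
      using bound
    proof eventually_elim
      fix r assume r: "\<forall>x. norm (B r *v x) \<le> q * norm x"
      then have b: "\<And>x. norm (B r *v x) \<le> q * norm x" by blast
      have "matrix_inv (mat 1 - B r) *v y r - v = matrix_inv (mat 1 - B r) *v (y r - (mat 1 - B r) *v v)"
        by (simp add: matrix_vector_mult_diff_distrib matrix_vector_mul_assoc
            matrix_inv_left[OF one_minus_invertible[OF b q]])
      then show "norm (matrix_inv (mat 1 - B r) *v y r - v) \<le> norm (y r - (mat 1 - B r) *v v) / (1 - q)"
        using norm_resolvent_le[OF b q] by simp
    qed
  qed
  then show ?thesis by (simp add: LIM_zero_iff v_def)
qed


section \<open>The inner function and its resolvent as multipliers\<close>

text \<open>
  The standing data: a strict contraction \<open>W\<close>, with a bound \<open>q < 1\<close> of its norm, and an inner function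
  \<open>\<Theta>\<close> with boundary function \<open>T\<close>. The matrix \<open>resolvent A\<close> is \<open>(I - AW\<^sup>*)\<^sup>-\<^sup>1\<close>; it is applied to
  \<open>A = \<Theta> z\<close> in the disc and to \<open>A = T t\<close> on the circle.
\<close>

locale contraction_and_inner =
  fixes W :: "complex ^ 'd ^ 'd" and q :: real and \<Theta> :: "complex \<Rightarrow> complex ^ 'd ^ 'd"
  assumes q: "0 \<le> q" "q < 1" and W: "\<And>x. norm (W *v x) \<le> q * norm x"
    and inner: "inner_function \<Theta>"
begin

abbreviation T :: "real \<Rightarrow> complex ^ 'd ^ 'd" where "T \<equiv> boundary \<Theta>"

abbreviation resolvent :: "complex ^ 'd ^ 'd \<Rightarrow> complex ^ 'd ^ 'd" where
  "resolvent A \<equiv> matrix_inv (mat 1 - A ** adj W)"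

lemma T_unitary: "AE t in circle. unitary_matrix (T t)"
  using inner by (simp add: inner_function_def)

lemma T_radial: "AE t in circle. ((\<lambda>r. \<Theta> (of_real r * cis t)) \<longlongrightarrow> T t) (at_left 1)"
  using inner by (simp add: inner_function_def hardy2_def)

lemma entry: "hardy_pair (\<lambda>z. \<Theta> z $ i $ j) (\<lambda>t. T t $ i $ j)"
  by (rule hardy2_component[OF bounded_bilinear_smult_matrix, where p = "\<lambda>A. A $ i $ j"])
    (use inner in \<open>auto simp: inner_function_def smult_matrix_def
      intro: bounded_linear_compose[OF bounded_linear_vec_nth bounded_linear_vec_nth]\<close>)

lemma entry_bounded: "AE t in circle. norm (T t $ i $ j) \<le> 1"
  using T_unitary
proof eventually_elim
  fix t assume U: "unitary_matrix (T t)"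
  have "norm (T t $ i $ j) = norm ((T t *v axis j 1) $ i)"
    by (simp add: matrix_vector_axis)
  also have "\<dots> \<le> norm (T t *v axis j 1)"
    by (rule Finite_Cartesian_Product.norm_nth_le)
  also have "\<dots> = norm (axis j (1::complex) :: complex ^ 'd)" by (rule unitary_norm[OF U])
  also have "\<dots> = 1" by (rule norm_axis_one)
  finally show "norm (T t $ i $ j) \<le> 1" .
qed

lemma hardy_vec_inner: "hardy_vec F U \<Longrightarrow> hardy_vec (\<lambda>z. \<Theta> z *v F z) (\<lambda>t. T t *v U t)"
  unfolding hardy_vec_def matrix_vector_mult_def
  by (auto intro!: hardy_pair_sum hardy_pair_mult[OF entry _ entry_bounded])

lemma inner_contraction:
  assumes z: "norm z < 1"
  shows "norm (\<Theta> z *v x) \<le> norm x"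
proof -
  \<comment> \<open>The bound for the scalar function \<open>w \<mapsto> \<langle>\<Theta> w x, y\<rangle>\<close>, taken at \<open>w = z\<close> and \<open>y = \<Theta> z x\<close>.\<close>
  define y where "y = \<Theta> z *v x"
  have "hardy_pair (\<lambda>z. cinner (\<Theta> z *v x) y) (\<lambda>t. cinner (T t *v x) y)"
    unfolding cinner_eq_sum by (intro hardy_pair_sum hardy_pair_cmult entry)
  moreover have "AE t in circle. norm (cinner (T t *v x) y) \<le> norm x * norm y"
    using T_unitary
    by eventually_elim (metis cinner_Cauchy_Schwarz unitary_norm)
  ultimately have "norm (cinner (\<Theta> z *v x) y) \<le> norm x * norm y"
    by (rule hardy_pair_bound[OF _ _ z]) simp
  then have "norm y * norm y \<le> norm x * norm y"
    unfolding y_def[symmetric] cinner_self norm_of_real by (simp add: power2_eq_square)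
  then show ?thesis
    unfolding y_def[symmetric] by (cases "norm y = 0") (auto simp: mult_le_cancel_right)
qed

lemma mult_adj_W_bound:
  assumes "\<And>x. norm (A *v x) \<le> norm x"
  shows "norm ((A ** adj W) *v x) \<le> q * norm x"
  using order_trans[OF assms norm_adj_le[OF W]] by (simp add: matrix_vector_mul_assoc[symmetric])

lemmas mult_adj_W_bound_disc = mult_adj_W_bound[OF inner_contraction]

lemma mult_adj_W_bound_unitary: "unitary_matrix A \<Longrightarrow> norm ((A ** adj W) *v x) \<le> q * norm x"
  by (rule mult_adj_W_bound) (simp add: unitary_norm)

lemma hardy_vec_neumann:
  assumes FU: "hardy_vec F U"
  shows "hardy_vec (\<lambda>z. neumann (\<Theta> z ** adj W) (F z) N) (\<lambda>t. neumann (T t ** adj W) (U t) N)"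
proof (induction N)
  case (Suc N)
  show ?case
    using hardy_vec_add[OF FU hardy_vec_inner[OF hardy_vec_matrix[OF Suc, of "adj W"]]]
    by (simp add: matrix_vector_mul_assoc)
qed (simp add: hardy_vec_zero)

text \<open>
  The radial limits of \<open>(I - \<Theta>W\<^sup>*)\<^sup>-\<^sup>1 F\<close> come from the continuity of the resolvent. Membership in the Hardy
  space comes from the Neumann partial sums, whose error on the circle is at most \<open>q ^ N / (1 - q)\<close>
  times the norm of the boundary function \<open>U\<close>.
\<close>

lemma hardy_vec_resolvent:
  assumes FU: "hardy_vec F U"
  shows "hardy_vec (\<lambda>z. resolvent (\<Theta> z) *v F z) (\<lambda>t. resolvent (T t) *v U t)"
  unfolding hardy_vec_def
proof
  fix i
  let ?u = "\<lambda>N t. neumann (T t ** adj W) (U t) N" and ?v = "\<lambda>t. resolvent (T t) *v U t"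
  have pair: "hardy_pair (\<lambda>z. neumann (\<Theta> z ** adj W) (F z) N $ i) (\<lambda>t. ?u N t $ i)" for N
    using hardy_vec_neumann[OF FU] by (simp add: hardy_vec_def)
  have err: "AE t in circle. norm (?u N t $ i - ?v t $ i) \<le> q ^ N * (norm (U t) / (1 - q))" for N
    using T_unitary
  proof eventually_elim
    fix t assume "unitary_matrix (T t)"
    then have "norm (?u N t - ?v t) \<le> q ^ N * (norm (U t) / (1 - q))"
      by (intro neumann_error q mult_adj_W_bound_unitary)
    then show "norm (?u N t $ i - ?v t $ i) \<le> q ^ N * (norm (U t) / (1 - q))"
      using Finite_Cartesian_Product.norm_nth_le[of "?u N t - ?v t" i] by (simp only: vector_minus_component)
  qed
  note UL2 = hardy_vec_L2[OF FU]
  have lim: "AE t in circle. (\<lambda>N. ?u N t $ i) \<longlonglongrightarrow> ?v t $ i"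
    using T_unitary
    by eventually_elim (intro tendsto_vec_nth neumann_tendsto[where q = q] q mult_adj_W_bound_unitary)
  have vmeas: "(\<lambda>t. ?v t $ i) \<in> borel_measurable circle"
    by (rule measurable_circle_lim[OF _ lim]) (rule L2_measurable[OF hardy_pairD(2)[OF pair]])
  have vL2: "(\<lambda>t. ?v t $ i) \<in> L2_circle"
  proof (rule L2_bound[OF vmeas])
    show "integrable circle (\<lambda>t. (1 / (1 - q))\<^sup>2 * (norm (U t))\<^sup>2)"
      by (intro integrable_mult_right L2_integrable_norm2 UL2)
    show "AE t in circle. (norm (?v t $ i))\<^sup>2 \<le> (1 / (1 - q))\<^sup>2 * (norm (U t))\<^sup>2"
      using err[of 0]
    proof eventually_elim
      case (elim t)
      then have "norm (?v t $ i) \<le> 1 / (1 - q) * norm (U t)" by simp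
      from power_mono[OF this, of 2] show ?case
        by (simp only: power_mult_distrib norm_ge_zero)
    qed
  qed
  show "hardy_pair (\<lambda>z. (resolvent (\<Theta> z) *v F z) $ i) (\<lambda>t. ?v t $ i)"
  proof (rule hardy_pair_L1_limit[OF pair _ _ vL2])
    show "(\<lambda>N. neumann (\<Theta> z ** adj W) (F z) N $ i) \<longlonglongrightarrow> (resolvent (\<Theta> z) *v F z) $ i"
      if "norm z < 1" for z
      by (intro tendsto_vec_nth neumann_tendsto[where q = q] q mult_adj_W_bound_disc that)
    show "AE t in circle. ((\<lambda>r. (resolvent (\<Theta> (of_real r * cis t)) *v F (of_real r * cis t)) $ i) \<longlongrightarrow> ?v t $ i) (at_left 1)"
      using T_unitary T_radial hardy_vec_radial[OF FU]
    proof eventually_elim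
      case (elim t)
      have "\<forall>\<^sub>F r in at_left 1. \<forall>x. norm ((\<Theta> (of_real r * cis t) ** adj W) *v x) \<le> q * norm x"
        using eventually_at_left_real[of "0::real" 1]
        by (rule eventually_mono) (auto intro!: mult_adj_W_bound_disc simp: norm_mult)
      moreover have "((\<lambda>r. \<Theta> (of_real r * cis t) ** adj W) \<longlongrightarrow> T t ** adj W) (at_left 1)"
        unfolding matrix_matrix_mult_def by (intro tendsto_intros elim)
      ultimately show ?case
        by (intro tendsto_vec_nth resolvent_tendsto[where q = q] q mult_adj_W_bound_unitary elim)
    qed
    have int: "integrable circle (\<lambda>t. norm (U t) / (1 - q))"
      by (intro integrable_divide_zero integrable_norm L2_integrable UL2)
    have bound: "(LINT t|circle. norm (?u N t $ i - ?v t $ i)) \<le> q ^ N * (LINT t|circle. norm (U t) / (1 - q))" for N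
    proof -
      have "(LINT t|circle. norm (?u N t $ i - ?v t $ i)) \<le> (LINT t|circle. q ^ N * (norm (U t) / (1 - q)))"
        by (intro integral_mono_AE integrable_norm L2_integrable L2_diff hardy_pairD(2)[OF pair] vL2
            integrable_mult_right int err)
      then show ?thesis by (simp only: integral_mult_right_zero)
    qed
    have lim0: "(\<lambda>N. q ^ N * (LINT t|circle. norm (U t) / (1 - q))) \<longlonglongrightarrow> 0"
      using q by (intro tendsto_mult_left_zero LIMSEQ_realpow_zero) auto
    show "(\<lambda>N. LINT t|circle. norm (?u N t $ i - ?v t $ i)) \<longlonglongrightarrow> 0"
      by (rule tendsto_sandwich[OF _ _ tendsto_const lim0])
        (use bound in \<open>auto intro!: always_eventually integral_nonneg_AE\<close>)
  qed
qed


section \<open>Matrix identities at unitary values\<close>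

text \<open>
  The defect operators \<open>D\<^sub>W\<close> and \<open>D\<^bsub>W*\<^esub>\<close>. The comments write \<open>D\<^sub>*\<close> for \<open>D'\<close>.
\<close>

abbreviation D where "D \<equiv> defect W"
abbreviation D' where "D' \<equiv> defect (adj W)"

lemmas D_props = defect_properties[OF q W]
lemmas D'_props = defect_properties[OF q norm_adj_le[OF W], simplified]
lemmas D_W = defect_intertwining[OF q W]
lemmas D_inv = posdef_invertible[OF D_props(2)]
lemmas D'_inv = posdef_invertible[OF D'_props(2)]

context
  fixes A :: "complex ^ 'd ^ 'd"
  assumes A: "unitary_matrix A"
begin

lemma resolvent_inverse:
  "(mat 1 - A ** adj W) ** resolvent A = mat 1" "resolvent A ** (mat 1 - A ** adj W) = mat 1"
  by (intro matrix_inv_left matrix_inv_right one_minus_invertible[OF mult_adj_W_bound_unitary[OF A] q])+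

lemma adj_resolvent_inverse: "adj (resolvent A) ** (mat 1 - W ** adj A) = mat 1"
  using arg_cong[OF resolvent_inverse(1), of adj] by (simp add: adj_mult adj_diff)

lemma unitary_cancel: "X ** adj A ** A = X" "X ** A ** adj A = X"
  using A by (simp_all add: unitary_matrix_def matrix_mul_assoc[symmetric])

text \<open>
  With \<open>X = AW\<^sup>*\<close> and \<open>Y = X\<^sup>* = WA\<^sup>*\<close>, the middle factor \<open>D\<^sub>*\<^sup>2 = I - WW\<^sup>*\<close> equals \<open>I - YX\<close>, which is
  \<open>(I - Y)(I - X) + (I - Y)X + Y(I - X)\<close>.
\<close>

lemma multiplier_gram:
  "adj (D' ** resolvent A) ** (D' ** resolvent A)
    = mat 1 + A ** adj W ** resolvent A + adj (A ** adj W ** resolvent A)"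
proof -
  let ?R = "resolvent A" and ?X = "A ** adj W" and ?Y = "W ** adj A"
  have "adj (D' ** ?R) ** (D' ** ?R) = adj ?R ** (mat 1 - W ** adj W) ** ?R"
    unfolding D'_props(3)[symmetric] by (simp add: adj_mult D'_props(1) matrix_mul_assoc)
  also have "mat 1 - W ** adj W = (mat 1 - ?Y) ** (mat 1 - ?X) + (mat 1 - ?Y) ** ?X + ?Y ** (mat 1 - ?X)"
    by (simp add: matrix_diff_ldistrib matrix_diff_rdistrib matrix_mul_assoc unitary_cancel)
  also have "adj ?R ** \<dots> ** ?R = (adj ?R ** (mat 1 - ?Y)) ** ((mat 1 - ?X) ** ?R)
      + (adj ?R ** (mat 1 - ?Y)) ** ?X ** ?R + adj ?R ** ?Y ** ((mat 1 - ?X) ** ?R)"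
    by (simp only: matrix_add_ldistrib matrix_add_rdistrib matrix_mul_assoc)
  also have "\<dots> = mat 1 + ?X ** ?R + adj (?X ** ?R)"
    unfolding resolvent_inverse adj_resolvent_inverse by (simp add: adj_mult)
  finally show ?thesis .
qed

text \<open>
  The relation \<open>D\<^sub>*W = WD\<close> gives \<open>VD = D\<^sub>*R(A - W)\<close> for the matrix \<open>V = -W + D\<^sub>*RAD\<close>. As \<open>A - W = (I - Y)A\<close>,
  the claim, multiplied by \<open>I - Y\<close> from the left and by \<open>D\<close> from the right, reduces to
  \<open>(I - YX) R (I - Y) = (I - Y) R (I - XY)\<close>.
\<close>

lemma multiplier_adj_moebius:
  "adj (D' ** resolvent A) ** (- W + D' ** resolvent A ** A ** D) = resolvent A ** A ** D"
proof -
  let ?R = "resolvent A" and ?X = "A ** adj W" and ?Y = "W ** adj A"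
  let ?V = "- W + D' ** ?R ** A ** D"
  have "?V ** D = - (D' ** W) + D' ** ?R ** A ** (D ** D)"
    by (simp add: matrix_add_rdistrib matrix_diff_rdistrib matrix_mul_assoc D_W)
  also have "\<dots> = D' ** (?R ** (A - A ** adj W ** W)) - D' ** W"
    by (simp add: D_props(3) matrix_diff_ldistrib matrix_mul_assoc)
  also have "D' ** W = D' ** ((?R ** (mat 1 - ?X)) ** W)"
    by (simp add: resolvent_inverse)
  also have "\<dots> = D' ** (?R ** (W - A ** adj W ** W))"
    by (simp only: matrix_mul_assoc[symmetric] matrix_diff_rdistrib matrix_mul_lid)
  also have "D' ** (?R ** (A - A ** adj W ** W)) - D' ** (?R ** (W - A ** adj W ** W)) = D' ** (?R ** (A - W))"
    by (simp add: matrix_diff_ldistrib)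
  finally have V: "?V ** D = D' ** (?R ** (A - W))" .
  have "A - W = (mat 1 - ?Y) ** A"
    by (simp add: matrix_diff_rdistrib unitary_cancel)
  then have "D' ** (?V ** D) = (mat 1 - W ** adj W) ** ?R ** (mat 1 - ?Y) ** A"
    unfolding V D'_props(3)[symmetric] by (simp add: matrix_mul_assoc)
  also have "mat 1 - W ** adj W = (mat 1 - ?Y) + ?Y ** (mat 1 - ?X)"
    by (simp add: matrix_diff_ldistrib matrix_mul_assoc unitary_cancel)
  also have "\<dots> ** ?R ** (mat 1 - ?Y) = (mat 1 - ?Y) ** ?R ** (mat 1 - ?Y) + ?Y ** ((mat 1 - ?X) ** ?R) ** (mat 1 - ?Y)"
    by (simp only: matrix_add_rdistrib matrix_mul_assoc)
  also have "\<dots> = (mat 1 - ?Y) ** ?R ** (mat 1 - ?Y) + (mat 1 - ?Y) ** (?R ** (mat 1 - ?X)) ** ?Y"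
    unfolding resolvent_inverse by (simp add: matrix_diff_rdistrib matrix_diff_ldistrib)
  also have "\<dots> = (mat 1 - ?Y) ** ?R ** ((mat 1 - ?Y) + (mat 1 - ?X) ** ?Y)"
    by (simp only: matrix_add_ldistrib matrix_mul_assoc)
  also have "(mat 1 - ?Y) + (mat 1 - ?X) ** ?Y = mat 1 - A ** adj W ** W ** adj A"
    by (simp add: matrix_diff_rdistrib matrix_mul_assoc)
  also have "(mat 1 - ?Y) ** ?R ** (mat 1 - A ** adj W ** W ** adj A) ** A
      = (mat 1 - ?Y) ** ?R ** (A ** (D ** D))"
    by (simp add: D_props(3) matrix_diff_rdistrib matrix_diff_ldistrib matrix_mul_assoc unitary_cancel)
  finally have "adj ?R ** (D' ** (?V ** D)) = (adj ?R ** (mat 1 - ?Y)) ** ?R ** (A ** (D ** D))"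
    by (simp add: matrix_mul_assoc)
  then have "adj ?R ** D' ** ?V ** D = ?R ** A ** D ** D"
    unfolding adj_resolvent_inverse by (simp add: matrix_mul_assoc)
  then have "adj ?R ** D' ** ?V ** (D ** matrix_inv D) = ?R ** A ** D ** (D ** matrix_inv D)"
    by (simp only: matrix_mul_assoc)
  then show ?thesis
    by (simp add: matrix_inv_right[OF D_inv] adj_mult D'_props(1))
qed

lemma resolvent_mult: "resolvent A ** A = A + A ** adj W ** resolvent A ** A"
proof -
  have "resolvent A ** A - A ** adj W ** resolvent A ** A = ((mat 1 - A ** adj W) ** resolvent A) ** A"
    by (simp only: matrix_diff_rdistrib matrix_mul_lid)
  then show ?thesis by (simp add: resolvent_inverse diff_eq_eq)
qed

end


section \<open>The operator between the model spaces\<close>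

lemma hardy_vec_multiplier:
  assumes "hardy_vec F U"
  shows "hardy_vec (\<lambda>z. (D' ** resolvent (\<Theta> z)) *v F z) (\<lambda>t. (D' ** resolvent (T t)) *v U t)"
  using hardy_vec_matrix[OF hardy_vec_resolvent[OF assms], of D']
  by (simp add: matrix_vector_mul_assoc)

text \<open>
  The operator Moebius transformation \<open>A \<mapsto> -W + D\<^sub>*(I - AW\<^sup>*)\<^sup>-\<^sup>1AD\<close>, which takes \<open>\<Theta>\<close> to \<open>\<Theta>'\<close>.
\<close>

definition moebius :: "complex ^ 'd ^ 'd \<Rightarrow> complex ^ 'd ^ 'd" where
  "moebius A = - W + D' ** resolvent A ** A ** D"

lemma hardy_vec_moebius:
  assumes FU: "hardy_vec F U"
  shows "hardy_vec (\<lambda>z. moebius (\<Theta> z) *v F z) (\<lambda>t. moebius (T t) *v U t)"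
proof -
  have "hardy_vec (\<lambda>z. (- W) *v F z + (D' ** resolvent (\<Theta> z)) *v (\<Theta> z *v (D *v F z)))
      (\<lambda>t. (- W) *v U t + (D' ** resolvent (T t)) *v (T t *v (D *v U t)))"
    by (intro hardy_vec_add hardy_vec_matrix hardy_vec_multiplier hardy_vec_inner FU)
  then show ?thesis
    by (simp only: moebius_def matrix_vector_mult_add_rdistrib matrix_vector_mul_assoc matrix_mul_assoc)
qed

lemma model_space_inner_iff:
  "f \<in> model_space \<Theta> \<longleftrightarrow>
    f \<in> H2 \<and> (\<forall>G V. hardy_vec G V \<longrightarrow> (LINT t|circle. cinner (boundary f t) (T t *v V t)) = 0)"
  by (rule model_space_iff[OF hardy_vec_inner])

context
  fixes \<Theta>' :: "complex \<Rightarrow> complex ^ 'd ^ 'd"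
    and J :: "(complex \<Rightarrow> complex ^ 'd) \<Rightarrow> complex \<Rightarrow> complex ^ 'd"
  assumes \<Theta>': "\<And>z. z \<in> ball 0 1 \<Longrightarrow> \<Theta>' z = moebius (\<Theta> z)"
    and J: "\<And>f z. J f z = (D' ** resolvent (\<Theta> z)) *v f z"
begin

lemma model_space_moebius_iff:
  "f \<in> model_space \<Theta>' \<longleftrightarrow>
    f \<in> H2 \<and> (\<forall>G V. hardy_vec G V \<longrightarrow> (LINT t|circle. cinner (boundary f t) (moebius (T t) *v V t)) = 0)"
  by (rule model_space_iff, rule hardy_vec_cong_disc[OF hardy_vec_moebius]) (simp_all add: \<Theta>')

lemma hardy_vec_J:
  assumes "f \<in> H2"
  shows "hardy_vec (J f) (\<lambda>t. (D' ** resolvent (T t)) *v boundary f t)"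
  unfolding J by (rule hardy_vec_multiplier) (use assms in \<open>simp add: H2_iff\<close>)

lemma J_H2: "f \<in> H2 \<Longrightarrow> J f \<in> H2"
  by (rule H2_I[OF hardy_vec_J]) (simp_all add: J H2_iff)

text \<open>
  The adjoint relation \<open>\<langle>Jf, \<Theta>'g\<rangle> = \<langle>f, R\<Theta>Dg\<rangle>\<close> on the whole Hardy space. It shows both that \<open>J\<close> maps into the
  model space of \<open>\<Theta>'\<close> and that it is onto.
\<close>

lemma integral_J_moebius:
  assumes f: "f \<in> H2" and GV: "hardy_vec G V"
  shows "(LINT t|circle. cinner (boundary (J f) t) (moebius (T t) *v V t))
    = (LINT t|circle. cinner (boundary f t) ((resolvent (T t) ** T t ** D) *v V t))"
proof (rule integral_cong_AE)
  have "hardy_vec (\<lambda>z. resolvent (\<Theta> z) *v (\<Theta> z *v (D *v G z))) (\<lambda>t. resolvent (T t) *v (T t *v (D *v V t)))"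
    by (intro hardy_vec_resolvent hardy_vec_inner hardy_vec_matrix GV)
  then show "(\<lambda>t. cinner (boundary f t) ((resolvent (T t) ** T t ** D) *v V t)) \<in> borel_measurable circle"
    using f by (intro borel_measurable_integrable cinner_integrable[of f])
      (auto simp: H2_iff matrix_vector_mul_assoc matrix_mul_assoc)
  show "(\<lambda>t. cinner (boundary (J f) t) (moebius (T t) *v V t)) \<in> borel_measurable circle"
    using J_H2[OF f] hardy_vec_moebius[OF GV]
    by (intro borel_measurable_integrable cinner_integrable[of "J f"]) (auto simp: H2_iff)
  show "AE t in circle. cinner (boundary (J f) t) (moebius (T t) *v V t)
      = cinner (boundary f t) ((resolvent (T t) ** T t ** D) *v V t)"
    using hardy_vec_boundary[OF hardy_vec_J[OF f]] T_unitary
    by eventually_elim (simp only: cinner_adj matrix_vector_mul_assoc moebius_def multiplier_adj_moebius)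
qed

lemma J_model_space:
  assumes f: "f \<in> model_space \<Theta>"
  shows "J f \<in> model_space \<Theta>'"
  unfolding model_space_moebius_iff
proof (intro conjI allI impI)
  have fH: "f \<in> H2" using f by (simp add: model_space_inner_iff)
  then show "J f \<in> H2" by (rule J_H2)
  fix G :: "complex \<Rightarrow> complex ^ 'd" and V assume GV: "hardy_vec G V"
  \<comment> \<open>\<open>R\<Theta>Dg\<close> is \<open>\<Theta>\<close> times the Hardy function \<open>Dg + W\<^sup>*R\<Theta>Dg\<close>.\<close>
  let ?V = "\<lambda>t. D *v V t + adj W *v (resolvent (T t) *v (T t *v (D *v V t)))"
  have "hardy_vec (\<lambda>z. D *v G z + adj W *v (resolvent (\<Theta> z) *v (\<Theta> z *v (D *v G z)))) ?V"
    by (intro hardy_vec_add hardy_vec_matrix hardy_vec_resolvent hardy_vec_inner GV)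
  then have 0: "(LINT t|circle. cinner (boundary f t) (T t *v ?V t)) = 0"
    and int: "integrable circle (\<lambda>t. cinner (boundary f t) (T t *v ?V t))"
    using f fH hardy_vec_inner by (auto simp: model_space_inner_iff H2_iff intro!: cinner_integrable[of f])
  have int': "integrable circle (\<lambda>t. cinner (boundary f t) ((resolvent (T t) ** T t ** D) *v V t))"
    using hardy_vec_resolvent[OF hardy_vec_inner[OF hardy_vec_matrix[OF GV, of D]]] fH
    by (intro cinner_integrable[of f]) (auto simp: H2_iff matrix_vector_mul_assoc matrix_mul_assoc)
  have "(LINT t|circle. cinner (boundary f t) ((resolvent (T t) ** T t ** D) *v V t))
      = (LINT t|circle. cinner (boundary f t) (T t *v ?V t))"
  proof (rule integral_cong_AE)
    show "AE t in circle. cinner (boundary f t) ((resolvent (T t) ** T t ** D) *v V t)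
        = cinner (boundary f t) (T t *v ?V t)"
      using T_unitary
    proof eventually_elim
      case (elim t)
      have "(resolvent (T t) ** T t ** D) *v V t = T t *v ?V t"
        by (subst resolvent_mult[OF elim])
          (simp only: matrix_add_rdistrib matrix_vector_mult_add_rdistrib
            matrix_vector_right_distrib matrix_vector_mul_assoc matrix_mul_assoc)
      then show ?case by simp
    qed
  qed (use int int' in auto)
  then show "(LINT t|circle. cinner (boundary (J f) t) (moebius (T t) *v V t)) = 0"
    by (simp add: integral_J_moebius[OF fH GV] 0)
qed

lemma J_inner:
  assumes f: "f \<in> model_space \<Theta>" and g: "g \<in> model_space \<Theta>"
  shows "H2_inner (J f) (J g) = H2_inner f g"
proof -
  have fH: "f \<in> H2" and gH: "g \<in> H2" using f g by (auto simp: model_space_inner_iff)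
  then have f': "hardy_vec f (boundary f)" and g': "hardy_vec g (boundary g)" by (auto simp: H2_iff)
  let ?h = "\<lambda>F t. adj W *v (resolvent (T t) *v boundary F t)"
  have h: "hardy_vec (\<lambda>z. adj W *v (resolvent (\<Theta> z) *v F z)) (?h F)"
    if "hardy_vec F (boundary F)" for F :: "complex \<Rightarrow> complex ^ 'd"
    by (intro hardy_vec_matrix hardy_vec_resolvent that)
  note int = cinner_integrable[OF f' g'] cinner_integrable[OF f' hardy_vec_inner[OF h[OF g']]]
    cinner_integrable[OF hardy_vec_inner[OF h[OF f']] g']
  have 1: "(LINT t|circle. cinner (boundary f t) (T t *v ?h g t)) = 0"
    using f h[OF g'] by (auto simp: model_space_inner_iff)
  have "(LINT t|circle. cinner (T t *v ?h f t) (boundary g t))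
      = (LINT t|circle. cnj (cinner (boundary g t) (T t *v ?h f t)))"
    by (intro Bochner_Integration.integral_cong refl cinner_commute)
  also have "\<dots> = cnj (LINT t|circle. cinner (boundary g t) (T t *v ?h f t))"
    by (rule Bochner_Integration.integral_cnj)
  also have "\<dots> = 0"
    using g h[OF f'] by (auto simp: model_space_inner_iff)
  finally have 2: "(LINT t|circle. cinner (T t *v ?h f t) (boundary g t)) = 0" .
  have "(LINT t|circle. cinner ((D' ** resolvent (T t)) *v boundary f t) ((D' ** resolvent (T t)) *v boundary g t))
      = (LINT t|circle. cinner (boundary f t) (boundary g t)
          + cinner (boundary f t) (T t *v ?h g t) + cinner (T t *v ?h f t) (boundary g t))"
  proof (rule integral_cong_AE)
    show "AE t in circle. cinner ((D' ** resolvent (T t)) *v boundary f t) ((D' ** resolvent (T t)) *v boundary g t)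
      = cinner (boundary f t) (boundary g t)
          + cinner (boundary f t) (T t *v ?h g t) + cinner (T t *v ?h f t) (boundary g t)"
      using T_unitary
    proof eventually_elim
      case (elim t)
      let ?Y = "T t ** adj W ** resolvent (T t)"
      have "cinner ((D' ** resolvent (T t)) *v boundary f t) ((D' ** resolvent (T t)) *v boundary g t)
          = cinner (boundary f t) ((mat 1 + ?Y + adj ?Y) *v boundary g t)"
        unfolding multiplier_gram[OF elim, symmetric] by (simp only: cinner_adj matrix_vector_mul_assoc)
      also have "\<dots> = cinner (boundary f t) (boundary g t) + cinner (boundary f t) (?Y *v boundary g t)
          + cinner (?Y *v boundary f t) (boundary g t)"
        by (simp only: matrix_vector_mult_add_rdistrib cinner_add_right matrix_vector_mul_lid cinner_adj)
      finally show ?case by (simp only: matrix_vector_mul_assoc matrix_mul_assoc)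
    qed
    show "(\<lambda>t. cinner ((D' ** resolvent (T t)) *v boundary f t) ((D' ** resolvent (T t)) *v boundary g t)) \<in> borel_measurable circle"
      by (intro borel_measurable_integrable cinner_integrable[OF hardy_vec_J[OF fH] hardy_vec_J[OF gH]])
  qed (use int in simp)
  also have "\<dots> = (LINT t|circle. cinner (boundary f t) (boundary g t))"
    using int 1 2 by simp
  finally show ?thesis
    unfolding H2_inner_eq[OF hardy_vec_J[OF fH] hardy_vec_J[OF gH]] H2_inner_eq[OF f' g'] by simp
qed

lemma J_inj:
  assumes "f \<in> H2" "g \<in> H2" "J f = J g"
  shows "f = g"
proof
  fix z
  show "f z = g z"
  proof (cases "z \<in> ball 0 1")
    case True
    then have z: "norm z < 1" by simp
    have "(mat 1 - \<Theta> z ** adj W) *v (matrix_inv D' *v J f z) = f z" for f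
    proof -
      have "(mat 1 - \<Theta> z ** adj W) *v (matrix_inv D' *v J f z)
          = ((mat 1 - \<Theta> z ** adj W) ** (matrix_inv D' ** D') ** resolvent (\<Theta> z)) *v f z"
        by (simp only: J matrix_vector_mul_assoc matrix_mul_assoc)
      then show ?thesis
        by (simp add: matrix_inv_left[OF D'_inv]
            matrix_inv_right[OF one_minus_invertible[OF mult_adj_W_bound_disc[OF z] q]])
    qed
    then show ?thesis using assms(3) by metis
  qed (use assms in \<open>simp add: H2_iff\<close>)
qed

lemma J_surj:
  assumes h: "h \<in> model_space \<Theta>'"
  shows "\<exists>f \<in> model_space \<Theta>. J f = h"
proof -
  have hH: "h \<in> H2" using h by (simp add: model_space_moebius_iff)
  let ?h = "\<lambda>z. matrix_inv D' *v h z"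
  define f where "f z = ?h z + (- mat 1) *v (\<Theta> z *v (adj W *v ?h z))" for z
  have "hardy_vec f (\<lambda>t. matrix_inv D' *v boundary h t
      + (- mat 1) *v (T t *v (adj W *v (matrix_inv D' *v boundary h t))))"
    unfolding f_def
    by (intro hardy_vec_add hardy_vec_matrix hardy_vec_inner) (use hH in \<open>simp_all add: H2_iff\<close>)
  then have fH: "f \<in> H2"
    by (rule H2_I) (use hH in \<open>simp add: f_def H2_iff\<close>)
  have f_eq: "f z = (mat 1 - \<Theta> z ** adj W) *v ?h z" for z
    by (simp add: f_def matrix_vector_mult_diff_rdistrib matrix_vector_uminus
        matrix_vector_mul_assoc[symmetric])
  have "J f z = h z" for z
  proof (cases "z \<in> ball 0 1")
    case True
    then have z: "norm z < 1" by simp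
    have "J f z = (D' ** (resolvent (\<Theta> z) ** (mat 1 - \<Theta> z ** adj W)) ** matrix_inv D') *v h z"
      by (simp only: J f_eq matrix_vector_mul_assoc matrix_mul_assoc)
    then show ?thesis
      by (simp add: matrix_inv_left[OF one_minus_invertible[OF mult_adj_W_bound_disc[OF z] q]]
          matrix_inv_right[OF D'_inv])
  qed (use hH in \<open>simp add: J f_eq H2_iff\<close>)
  then have Jf: "J f = h" by blast
  moreover have "f \<in> model_space \<Theta>"
    unfolding model_space_inner_iff
  proof (intro conjI allI impI fH)
    fix G :: "complex \<Rightarrow> complex ^ 'd" and V assume GV: "hardy_vec G V"
    \<comment> \<open>Chosen such that \<open>R\<Theta>D\<close> takes it to \<open>\<Theta>\<close> times \<open>G\<close>, by \<open>R\<Theta>(I - W\<^sup>*\<Theta>) = R(I - \<Theta>W\<^sup>*)\<Theta> = \<Theta>\<close>.\<close>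
    let ?V = "\<lambda>t. matrix_inv D *v (V t + (- adj W) *v (T t *v V t))"
    have k: "hardy_vec (\<lambda>z. matrix_inv D *v (G z + (- adj W) *v (\<Theta> z *v G z))) ?V"
      by (intro hardy_vec_add hardy_vec_matrix hardy_vec_inner GV)
    have "(LINT t|circle. cinner (boundary f t) ((resolvent (T t) ** T t ** D) *v ?V t)) = 0"
      using integral_J_moebius[OF fH k] h k by (simp add: Jf model_space_moebius_iff)
    moreover have "(LINT t|circle. cinner (boundary f t) (T t *v V t))
        = (LINT t|circle. cinner (boundary f t) ((resolvent (T t) ** T t ** D) *v ?V t))"
    proof (rule integral_cong_AE)
      show "AE t in circle. cinner (boundary f t) (T t *v V t)
          = cinner (boundary f t) ((resolvent (T t) ** T t ** D) *v ?V t)"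
        using T_unitary
      proof eventually_elim
        case (elim t)
        have V: "?V t = matrix_inv D *v ((mat 1 - adj W ** T t) *v V t)"
          by (simp add: matrix_vector_mult_diff_rdistrib matrix_vector_uminus
              matrix_vector_mul_assoc[symmetric])
        have "(resolvent (T t) ** T t ** D) *v ?V t
            = (resolvent (T t) ** T t ** (D ** matrix_inv D) ** (mat 1 - adj W ** T t)) *v V t"
          unfolding V by (simp only: matrix_vector_mul_assoc matrix_mul_assoc)
        also have "\<dots> = (resolvent (T t) ** (mat 1 - T t ** adj W) ** T t) *v V t"
          by (simp add: matrix_inv_right[OF D_inv] matrix_diff_ldistrib matrix_diff_rdistrib matrix_mul_assoc)
        also have "\<dots> = T t *v V t" by (simp add: resolvent_inverse[OF elim])
        finally show ?case by simp
      qed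
      show "(\<lambda>t. cinner (boundary f t) (T t *v V t)) \<in> borel_measurable circle"
        using fH by (intro borel_measurable_integrable cinner_integrable[of f, OF _ hardy_vec_inner[OF GV]])
          (auto simp: H2_iff)
      show "(\<lambda>t. cinner (boundary f t) ((resolvent (T t) ** T t ** D) *v ?V t)) \<in> borel_measurable circle"
        using hardy_vec_resolvent[OF hardy_vec_inner[OF hardy_vec_matrix[OF k, of D]]] fH
        by (intro borel_measurable_integrable cinner_integrable[of f])
          (auto simp: H2_iff matrix_vector_mul_assoc matrix_mul_assoc)
    qed
    ultimately show "(LINT t|circle. cinner (boundary f t) (T t *v V t)) = 0" by simp
  qed
  ultimately show ?thesis by blast
qed

lemma J_unitary: "unitary_operator (model_space \<Theta>) (model_space \<Theta>') J"
  unfolding unitary_operator_def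
proof (intro conjI ballI allI)
  show "bij_betw J (model_space \<Theta>) (model_space \<Theta>')"
  proof (rule bij_betw_imageI)
    show "inj_on J (model_space \<Theta>)"
      by (rule inj_onI, rule J_inj) (auto simp: model_space_inner_iff)
    show "J ` model_space \<Theta> = model_space \<Theta>'"
      using J_model_space J_surj by (auto simp: image_iff)
  qed
  show "J (\<lambda>z. F z + G z) = (\<lambda>z. J F z + J G z)" for F G
    by (simp add: J matrix_vector_right_distrib fun_eq_iff)
  show "J (\<lambda>z. c *s F z) = (\<lambda>z. c *s J F z)" for c F
    by (simp add: J fun_eq_iff vector_scalar_commute)
qed (rule J_inner)

end

end

theorem theorem3p3:
  fixes W :: "complex ^ 'd ^ 'd"
    and \<Theta> \<Theta>' :: "complex \<Rightarrow> complex ^ 'd ^ 'd"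
    and J :: "(complex \<Rightarrow> complex ^ 'd) \<Rightarrow> complex \<Rightarrow> complex ^ 'd"
  assumes "strict_contraction W"
    and "inner_function \<Theta>" and "pure \<Theta>"
    and "\<And>z. z \<in> ball 0 1 \<Longrightarrow>
           \<Theta>' z = - W + defect (adj W) ** matrix_inv (mat 1 - \<Theta> z ** adj W) ** \<Theta> z ** defect W"
    and "\<And>f z. J f z = (defect (adj W) ** matrix_inv (mat 1 - \<Theta> z ** adj W)) *v f z"
  shows "unitary_operator (model_space \<Theta>) (model_space \<Theta>') J"
proof -
  interpret contraction_and_inner W "opnorm W" \<Theta>
    by unfold_locales
      (use assms in \<open>auto simp: strict_contraction_def opnorm_nonneg norm_matrix_le_opnorm\<close>)
  show ?thesis
    by (rule J_unitary) (use assms in \<open>auto simp: moebius_def\<close>)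
qed

end
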